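(* Let $P_1,\ldots,P_m$ be special ample polytopes and suppose that $x\in\Lambda(P_1+\cdots+P_m)$ is winning. Then: (i) There exists a tuple $(x_1,\ldots,x_m)\in\Lambda(P_1)\times\cdots\times\Lambda(P_m)$ of winning elements such that $x=x_1+\cdots+x_m$; (ii) If $(x_1,\ldots,x_m),(x_1',\ldots,x_m')\in\Lambda(P_1)\times\cdots\times\Lambda(P_m)$ are two tuples of winning elements such that $x_1+\cdots+x_m=x=x_1'+\cdots+x_m'$, then the tuples are related by a sequence of root moves that only pass through tuples of winning elements.
   Context: Let $\Phi$ be an irreducible, reduced (finite, crystallographic) root system of rank $n$, with set of roots $\Delta$, root lattice $Y$, weight lattice $X \supseteq Y$, coroot lattice $X^\vee$, coweight lattice $Y^\vee$, and pairing $\langle\,,\rangle : X \times X^\vee \to \mathbb{Z}$ extended to $(X\otimes_{\mathbb Z}\mathbb{R})\times X^\vee$. Let $F_n$ be the set of Weyl chambers in $Y^\vee \otimes_{\mathbb Z} \mathbb{R}$. For $\sigma\in F_n$ let $\{\alpha_{i,\sigma} : i\in I\}$, $I=\{1,\dots,n\}$, be the corresponding simple roots; $x \in X\otimes_{\mathbb Z}\mathbb{R}$ is $\sigma$-dominant if $\langle x, \alpha_{i,\sigma}^\vee\rangle \ge 0$ for all $i$. For adjacent chambers $\sigma,\sigma'$, $\alpha_{\sigma,\sigma'}\in\Delta$ is the unique root positive on $\sigma$ and negative on $\sigma'$. An ample polytope is a convex polytope $P \subset X\otimes_{\mathbb Z}\mathbb{R}$ whose vertices are given by a set $\{\mu_\sigma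 : \sigma\in F_n\} \subset X$ such that for adjacent $\sigma,\sigma'$, $\mu_\sigma - \mu_{\sigma'} = r_{\sigma,\sigma'}\alpha_{\sigma,\sigma'}$ with $r_{\sigma,\sigma'} \in \mathbb{Z}_{>0}$. It is special if $\mu_\sigma$ is $\sigma$-dominant for every $\sigma$. Put $\Lambda(P) := P \cap (\mu_\sigma + Y)$ (independent of $\sigma$). Sums of polytopes are Minkowski sums; $P_1+\cdots+P_m$ is again a special ample polytope. Fix once and for all a dominant chamber, with simple roots $\alpha_i$, $i\in I$; dominant means dominant for it. Numbers game with a cutoff on $X$: the amplitude of $x\in X$ at $i\in I$ is $\langle x,\alpha_i^\vee\rangle$. An element is allowed if all its amplitudes are $\ge-1$; the game is played only from allowed elements. A move fires a vertex $i$ of negative amplitude (hence amplitude $-1$), replacing $x$ by $x-\langle x,\alpha_i^\vee\rangle\alpha_i=x+\alpha_i$. If a non-allowed element is reached the game is lost. The element $x$ is winning if one can reach, by finitely many (possibly zero) such moves passing only through allowed elements, an element with all amplitudes nonnegative. Root move: if $(x_1,\ldots,x_m)\in\Lambda(P_1)\times\cdots\times\Lambda(P_m)$, $\beta\in\Delta$, and $i\ne j$ are such that $x_i+\beta\in\Lambda(P_i)$ and $x_j-\beta\in\Lambda(P_j)$, then replacing $x_i$ by $x_i+\beta$ and $x_j$ by $x_j-\beta$ (other entries unchanged) is a root move. *)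

theory Defs
  imports "HOL-Analysis.Analysis" "HOL-Library.Set_Algebras"
begin

(* The ambient Euclidean space is X \<otimes> R. Its inner product is Weyl-invariant and is used to identify
   the space Y^vee \<otimes> R containing the chambers with X \<otimes> R; a coroot then pairs with x as follows. *)
definition copair :: "'a::euclidean_space \<Rightarrow> 'a \<Rightarrow> real" where
  "copair x \<alpha> = 2 * (x \<bullet> \<alpha>) / (\<alpha> \<bullet> \<alpha>)"

definition root_system :: "'a::euclidean_space set \<Rightarrow> bool" where
  "root_system \<Delta> \<longleftrightarrow> finite \<Delta> \<and> 0 \<notin> \<Delta> \<and> span \<Delta> = UNIV
    \<and> (\<forall>\<alpha>\<in>\<Delta>. \<forall>\<beta>\<in>\<Delta>. \<beta> - copair \<beta> \<alpha> *\<^sub>R \<alpha> \<in> \<Delta>)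
    \<and> (\<forall>\<alpha>\<in>\<Delta>. \<forall>\<beta>\<in>\<Delta>. copair \<beta> \<alpha> \<in> \<int>)"

definition reduced_roots :: "'a::euclidean_space set \<Rightarrow> bool" where
  "reduced_roots \<Delta> \<longleftrightarrow> (\<forall>\<alpha>\<in>\<Delta>. \<forall>c::real. c *\<^sub>R \<alpha> \<in> \<Delta> \<longrightarrow> c = 1 \<or> c = - 1)"

definition irreducible_roots :: "'a::euclidean_space set \<Rightarrow> bool" where
  "irreducible_roots \<Delta> \<longleftrightarrow> \<Delta> \<noteq> {} \<and>
    \<not> (\<exists>A B. A \<noteq> {} \<and> B \<noteq> {} \<and> A \<union> B = \<Delta> \<and> A \<inter> B = {} \<and> (\<forall>\<alpha>\<in>A. \<forall>\<beta>\<in>B. \<alpha> \<bullet> \<beta> = 0))"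

definition root_lattice :: "'a::euclidean_space set \<Rightarrow> 'a set" where
  "root_lattice \<Delta> = {(\<Sum>\<alpha>\<in>\<Delta>. of_int (c \<alpha>) *\<^sub>R \<alpha>) | c :: 'a \<Rightarrow> int. True}"

definition weight_lattice :: "'a::euclidean_space set \<Rightarrow> 'a set" where
  "weight_lattice \<Delta> = {x. \<forall>\<alpha>\<in>\<Delta>. copair x \<alpha> \<in> \<int>}"

definition chambers :: "'a::euclidean_space set \<Rightarrow> 'a set set" where
  "chambers \<Delta> = components (UNIV - (\<Union>\<alpha>\<in>\<Delta>. {v. \<alpha> \<bullet> v = 0}))"

definition positive_roots :: "'a::euclidean_space set \<Rightarrow> 'a set \<Rightarrow> 'a set" where
  "positive_roots \<Delta> \<sigma> = {\<alpha>\<in>\<Delta>. \<forall>v\<in>\<sigma>. \<alpha> \<bullet> v > 0}"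

definition simple_roots :: "'a::euclidean_space set \<Rightarrow> 'a set \<Rightarrow> 'a set" where
  "simple_roots \<Delta> \<sigma> = {\<alpha>\<in>positive_roots \<Delta> \<sigma>.
     \<not> (\<exists>\<beta>\<in>positive_roots \<Delta> \<sigma>. \<exists>\<gamma>\<in>positive_roots \<Delta> \<sigma>. \<alpha> = \<beta> + \<gamma>)}"

definition dominant_for :: "'a::euclidean_space set \<Rightarrow> 'a set \<Rightarrow> 'a \<Rightarrow> bool" where
  "dominant_for \<Delta> \<sigma> x \<longleftrightarrow> (\<forall>\<alpha>\<in>simple_roots \<Delta> \<sigma>. copair x \<alpha> \<ge> 0)"

definition adjacent_chambers :: "'a::euclidean_space set \<Rightarrow> 'a set \<Rightarrow> 'a set \<Rightarrow> bool" where
  "adjacent_chambers \<Delta> \<sigma> \<sigma>' \<longleftrightarrow> \<sigma> \<in> chambers \<Delta> \<and> \<sigma>' \<in> chambers \<Delta> \<and> \<sigma> \<noteq> \<sigma>'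
    \<and> (\<exists>F. F facet_of closure \<sigma> \<and> F facet_of closure \<sigma>')"

definition separating_root :: "'a::euclidean_space set \<Rightarrow> 'a set \<Rightarrow> 'a set \<Rightarrow> 'a" where
  "separating_root \<Delta> \<sigma> \<sigma>' =
     (THE \<alpha>. \<alpha> \<in> \<Delta> \<and> (\<forall>v\<in>\<sigma>. \<alpha> \<bullet> v > 0) \<and> (\<forall>v\<in>\<sigma>'. \<alpha> \<bullet> v < 0))"

definition ample_with_vertices ::
    "'a::euclidean_space set \<Rightarrow> ('a set \<Rightarrow> 'a) \<Rightarrow> 'a set \<Rightarrow> bool" where
  "ample_with_vertices \<Delta> \<mu> P \<longleftrightarrow>
     polytope P \<and> {v. v extreme_point_of P} = \<mu> ` chambers \<Delta>
   \<and> (\<forall>\<sigma>\<in>chambers \<Delta>. \<mu> \<sigma> \<in> weight_lattice \<Delta>)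
   \<and> (\<forall>\<sigma> \<sigma>'. adjacent_chambers \<Delta> \<sigma> \<sigma>' \<longrightarrow>
        (\<exists>r::int. r > 0 \<and> \<mu> \<sigma> - \<mu> \<sigma>' = of_int r *\<^sub>R separating_root \<Delta> \<sigma> \<sigma>'))"

definition special_ample_polytope :: "'a::euclidean_space set \<Rightarrow> 'a set \<Rightarrow> bool" where
  "special_ample_polytope \<Delta> P \<longleftrightarrow>
     (\<exists>\<mu>. ample_with_vertices \<Delta> \<mu> P \<and> (\<forall>\<sigma>\<in>chambers \<Delta>. dominant_for \<Delta> \<sigma> (\<mu> \<sigma>)))"

(* For an ample polytope the vertices are the \<mu> \<sigma>, which all lie in one coset of the root lattice. *)
definition Lambda_pts :: "'a::euclidean_space set \<Rightarrow> 'a set \<Rightarrow> 'a set" where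
  "Lambda_pts \<Delta> P = {x\<in>P. \<exists>v. v extreme_point_of P \<and> x - v \<in> root_lattice \<Delta>}"

(* In the numbers game C is the fixed dominant chamber; the vertices of the game are indexed by
   the simple roots themselves. *)
definition allowed :: "'a::euclidean_space set \<Rightarrow> 'a set \<Rightarrow> 'a \<Rightarrow> bool" where
  "allowed \<Delta> C x \<longleftrightarrow> x \<in> weight_lattice \<Delta> \<and> (\<forall>\<alpha>\<in>simple_roots \<Delta> C. copair x \<alpha> \<ge> - 1)"

definition game_move :: "'a::euclidean_space set \<Rightarrow> 'a set \<Rightarrow> 'a \<Rightarrow> 'a \<Rightarrow> bool" where
  "game_move \<Delta> C x y \<longleftrightarrow> allowed \<Delta> C x \<and>
     (\<exists>\<alpha>\<in>simple_roots \<Delta> C. copair x \<alpha> < 0 \<and> y = x - copair x \<alpha> *\<^sub>R \<alpha>)"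

definition winning :: "'a::euclidean_space set \<Rightarrow> 'a set \<Rightarrow> 'a \<Rightarrow> bool" where
  "winning \<Delta> C x \<longleftrightarrow> allowed \<Delta> C x \<and>
     (\<exists>y. (\<lambda>u w. game_move \<Delta> C u w \<and> allowed \<Delta> C w)\<^sup>*\<^sup>* x y \<and> dominant_for \<Delta> C y)"

definition Lambda_tuples ::
    "'a::euclidean_space set \<Rightarrow> nat \<Rightarrow> (nat \<Rightarrow> 'a set) \<Rightarrow> (nat \<Rightarrow> 'a) set" where
  "Lambda_tuples \<Delta> m P = (\<Pi>\<^sub>E i\<in>{1..m}. Lambda_pts \<Delta> (P i))"

definition winning_tuples ::
    "'a::euclidean_space set \<Rightarrow> 'a set \<Rightarrow> nat \<Rightarrow> (nat \<Rightarrow> 'a set) \<Rightarrow> (nat \<Rightarrow> 'a) set" where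
  "winning_tuples \<Delta> C m P = {xs\<in>Lambda_tuples \<Delta> m P. \<forall>i\<in>{1..m}. winning \<Delta> C (xs i)}"

definition root_move ::
    "'a::euclidean_space set \<Rightarrow> nat \<Rightarrow> (nat \<Rightarrow> 'a set) \<Rightarrow> (nat \<Rightarrow> 'a) \<Rightarrow> (nat \<Rightarrow> 'a) \<Rightarrow> bool" where
  "root_move \<Delta> m P xs ys \<longleftrightarrow> xs \<in> Lambda_tuples \<Delta> m P \<and>
     (\<exists>\<beta>\<in>\<Delta>. \<exists>i\<in>{1..m}. \<exists>j\<in>{1..m}. i \<noteq> j
        \<and> xs i + \<beta> \<in> Lambda_pts \<Delta> (P i) \<and> xs j - \<beta> \<in> Lambda_pts \<Delta> (P j)
        \<and> ys = xs(i := xs i + \<beta>, j := xs j - \<beta>))"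

end

(* The numbers game starting at x is won iff x pairs to at least -1 with every positive coroot, since a
   move is a simple reflection, which permutes the other positive roots. Walking from the dominant
   chamber C to any other chamber through walls, one sees that such a w lies in a special ample
   polytope P as soon as mu_C - w is a nonnegative integral combination of simple roots. So the
   winning points of Lambda(P) are the almost dominant weights below mu_C, and only C matters.

   Existence and connectedness are then proved by induction on the height of mu - x, where mu is the
   sum of the mu_C. If y pairs positively with the simple coroot of alpha, every tuple of sum y can be
   lowered by alpha in some entry, and root moves between tuples of sum y descend to root moves between
   their lowerings. It remains to see that every tuple of sum x is connected to a lowering of a tuple
   of sum x + alpha, for one fixed alpha: if x is not dominant, take alpha with pairing -1; if x is
   dominant, take alpha of minimal length among the simple roots occurring in mu - x. *)
theory Submission
  imports Defs
begin

subsection \<open>Roots, chambers and simple roots\<close>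

text \<open>Minimal length matters because adding a simple root \<open>s\<close> to a dominant
  weight can produce a pairing below -1 only with the coroot of a simple root shorter than
  \<open>s\<close>. Simple roots outside the support of \<mu> - x do no harm: a game started below
  \<mu> stays below \<mu>, so it never fires them. The coordinates of the differences \<mu>_j - x_j
  are nonnegative and cannot cancel, so every simple root that occurs in one entry also occurs in
  the total; one choice of \<open>s\<close> therefore works for all entries. Paths descend only
  under a positive pairing: the sum is constant along a path, so every tuple on it then has some
  entry that can be lowered. Adding \<alpha> provides this, since x + \<alpha> pairs with the coroot
  of \<alpha> to 1 if x is not dominant and to at least 2 if it is. Consecutive tuples of the path
  may have to be lowered at different entries. The two lowerings then differ by \<alpha> + \<beta>,
  where \<beta> is the root of the move, and the failure of a common entry forces a negative pairing
  that makes \<alpha> + \<beta> a root or 0.\<close>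

definition reflection :: "'a::euclidean_space \<Rightarrow> 'a \<Rightarrow> 'a" where
  "reflection \<alpha> x = x - copair x \<alpha> *\<^sub>R \<alpha>"

lemma copair_add: "copair (x + y) \<alpha> = copair x \<alpha> + copair y \<alpha>"
  by (simp add: copair_def inner_add_left distrib_left add_divide_distrib)

lemma copair_diff: "copair (x - y) \<alpha> = copair x \<alpha> - copair y \<alpha>"
  by (simp add: copair_def inner_diff_left right_diff_distrib diff_divide_distrib)

lemma copair_minus_right: "copair x (- \<alpha>) = - copair x \<alpha>"
  by (simp add: copair_def)

lemma copair_scaleR: "copair (c *\<^sub>R x) \<alpha> = c * copair x \<alpha>"
  by (simp add: copair_def)

lemma copair_sum: "copair (sum f A) \<alpha> = (\<Sum>a\<in>A. copair (f a) \<alpha>)"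
  by (simp add: copair_def inner_sum_left sum_distrib_left sum_divide_distrib)

lemma copair_self: "\<alpha> \<noteq> 0 \<Longrightarrow> copair \<alpha> \<alpha> = 2"
  by (simp add: copair_def)

lemma copair_nonneg_iff: "\<alpha> \<noteq> 0 \<Longrightarrow> copair x \<alpha> \<ge> 0 \<longleftrightarrow> x \<bullet> \<alpha> \<ge> 0"
  using inner_gt_zero_iff[of \<alpha>] by (auto simp: copair_def zero_le_divide_iff simp del: inner_gt_zero_iff)

lemma copair_pos_iff: "\<alpha> \<noteq> 0 \<Longrightarrow> copair x \<alpha> > 0 \<longleftrightarrow> x \<bullet> \<alpha> > 0"
  using inner_gt_zero_iff[of \<alpha>] by (auto simp: copair_def zero_less_divide_iff simp del: inner_gt_zero_iff)

lemma linear_reflection: "linear (reflection \<alpha>)"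
  by (rule linearI) (simp_all add: reflection_def copair_add copair_scaleR algebra_simps)

lemma inner_reflection:
  assumes "\<alpha> \<noteq> 0"
  shows "reflection \<alpha> x \<bullet> y = x \<bullet> reflection \<alpha> y"
  by (simp add: reflection_def inner_diff_left inner_diff_right copair_def inner_commute)

lemma reflection_reflection:
  assumes "\<alpha> \<noteq> 0"
  shows "reflection \<alpha> (reflection \<alpha> x) = x"
  by (simp add: reflection_def copair_diff copair_scaleR copair_self[OF assms])

lemma reflection_self: "\<alpha> \<noteq> 0 \<Longrightarrow> reflection \<alpha> \<alpha> = - \<alpha>"
  by (simp add: reflection_def copair_self scaleR_2)

text \<open>A reflection is an isometry, so it can be moved from the weight to the root. This turns
  a game move on a weight into a permutation of the roots it is tested against.\<close>

lemma copair_reflection: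
  assumes "\<alpha> \<noteq> 0"
  shows "copair (reflection \<alpha> x) y = copair x (reflection \<alpha> y)"
proof -
  have "reflection \<alpha> y \<bullet> reflection \<alpha> y = y \<bullet> y"
    using inner_reflection[OF assms] reflection_reflection[OF assms] by metis
  then show ?thesis
    by (simp add: copair_def inner_reflection[OF assms])
qed

lemma inj_reflection: "\<alpha> \<noteq> 0 \<Longrightarrow> inj (reflection \<alpha>)"
  by (metis injI reflection_reflection)

lemma Ints_pos_ge_1: "(k::real) \<in> \<int> \<Longrightarrow> k > 0 \<Longrightarrow> k \<ge> 1"
  by (auto elim!: Ints_cases)

lemma Ints_neg_le_minus_1: "(k::real) \<in> \<int> \<Longrightarrow> k < 0 \<Longrightarrow> k \<le> -1"
  by (auto elim!: Ints_cases)

lemma Nats_iff_nonneg_Ints: "(k::real) \<in> \<nat> \<longleftrightarrow> k \<in> \<int> \<and> k \<ge> 0"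
  by (metis Nats_altdef2 Nats_cases Nats_subset_Ints mem_Collect_eq of_nat_0_le_iff subsetD)

section \<open>Lengths, pairings and sums of roots\<close>

locale reduced_root_system =
  fixes \<Delta> :: "'a::euclidean_space set"
  assumes rs: "root_system \<Delta>" and red: "reduced_roots \<Delta>"
begin

lemma finite_roots: "finite \<Delta>" and root_nonzero: "\<alpha> \<in> \<Delta> \<Longrightarrow> \<alpha> \<noteq> 0"
  and span_roots: "span \<Delta> = UNIV"
  and reflection_root: "\<alpha> \<in> \<Delta> \<Longrightarrow> \<beta> \<in> \<Delta> \<Longrightarrow> reflection \<alpha> \<beta> \<in> \<Delta>"
  and copair_root_Ints: "\<alpha> \<in> \<Delta> \<Longrightarrow> \<beta> \<in> \<Delta> \<Longrightarrow> copair \<beta> \<alpha> \<in> \<int>"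
  using rs by (auto simp: root_system_def reflection_def)

lemma minus_root: "\<alpha> \<in> \<Delta> \<Longrightarrow> - \<alpha> \<in> \<Delta>"
  by (metis reflection_root reflection_self root_nonzero)

lemma proportional_roots:
  assumes "\<alpha> \<in> \<Delta>" "c *\<^sub>R \<alpha> \<in> \<Delta>"
  shows "c = 1 \<or> c = -1"
  using red assms by (auto simp: reduced_roots_def)

text \<open>Equality would make the two roots proportional, and reducedness leaves only
  \<open>\<alpha>\<close> and \<open>- \<alpha>\<close> on that line.\<close>

lemma strict_Cauchy_Schwarz_roots:
  assumes "\<alpha> \<in> \<Delta>" "\<beta> \<in> \<Delta>" "\<beta> \<noteq> \<alpha>" "\<beta> \<noteq> - \<alpha>"
  shows "\<bar>\<alpha> \<bullet> \<beta>\<bar> < norm \<alpha> * norm \<beta>"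
proof -
  have "\<bar>\<alpha> \<bullet> \<beta>\<bar> \<noteq> norm \<alpha> * norm \<beta>"
  proof
    assume "\<bar>\<alpha> \<bullet> \<beta>\<bar> = norm \<alpha> * norm \<beta>"
    then have "norm \<alpha> *\<^sub>R \<beta> = norm \<beta> *\<^sub>R \<alpha> \<or> norm \<alpha> *\<^sub>R \<beta> = - norm \<beta> *\<^sub>R \<alpha>"
      by (simp add: norm_cauchy_schwarz_abs_eq)
    then obtain d where d: "norm \<alpha> *\<^sub>R \<beta> = d *\<^sub>R \<alpha>"
      by blast
    have "\<beta> = (d / norm \<alpha>) *\<^sub>R \<alpha>"
    proof -
      have "\<beta> = (1 / norm \<alpha>) *\<^sub>R (norm \<alpha> *\<^sub>R \<beta>)"
        using root_nonzero[OF assms(1)] by simp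
      then show ?thesis unfolding d by simp
    qed
    then show False
      using proportional_roots[OF assms(1), of "d / norm \<alpha>"] assms by fastforce
  qed
  with Cauchy_Schwarz_ineq2[of \<alpha> \<beta>] show ?thesis by linarith
qed

text \<open>Strict Cauchy-Schwarz and the length bound give a pairing above -2, and integrality
  rounds this up to -1.\<close>

lemma copair_ge_minus_1_if_shorter:
  assumes "\<alpha> \<in> \<Delta>" "\<beta> \<in> \<Delta>" "\<beta> \<noteq> - \<alpha>" "norm \<beta> \<le> norm \<alpha>"
  shows "copair \<beta> \<alpha> \<ge> -1"
proof (cases "\<beta> = \<alpha>")
  case True
  then show ?thesis using copair_self[OF root_nonzero[OF assms(1)]] by simp
next
  case False
  have "norm \<alpha> * norm \<beta> \<le> norm \<alpha> * norm \<alpha>"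
    using assms(4) by (simp add: mult_left_mono)
  then have "\<beta> \<bullet> \<alpha> > - (\<alpha> \<bullet> \<alpha>)"
    using strict_Cauchy_Schwarz_roots[OF assms(1,2) False assms(3)]
    by (simp add: inner_commute norm_eq_square power2_norm_eq_inner[symmetric] power2_eq_square)
  moreover have "\<alpha> \<bullet> \<alpha> > 0" using root_nonzero[OF assms(1)] by simp
  ultimately have "copair \<beta> \<alpha> > -2"
    by (simp add: copair_def field_simps)
  moreover have "copair \<beta> \<alpha> \<in> \<int>" using copair_root_Ints assms by blast
  ultimately show ?thesis using Ints_pos_ge_1[of "copair \<beta> \<alpha> + 2"] by simp
qed

text \<open>The shorter of the two roots pairs to exactly -1 with the coroot of the other, so
  reflecting it adds the other root.\<close>

lemma add_root_if_copair_neg: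
  assumes "\<alpha> \<in> \<Delta>" "\<beta> \<in> \<Delta>" "copair \<beta> \<alpha> < 0" "\<beta> \<noteq> - \<alpha>"
  shows "\<alpha> + \<beta> \<in> \<Delta>"
proof -
  have neg: "\<alpha> \<bullet> \<beta> < 0"
    using assms(3) copair_nonneg_iff[OF root_nonzero[OF assms(1)]] by (simp add: inner_commute not_le[symmetric])
  then have "copair \<alpha> \<beta> < 0"
    using copair_nonneg_iff[OF root_nonzero[OF assms(2)]] by (simp add: not_le[symmetric])
  then have le: "copair \<beta> \<alpha> \<le> -1" "copair \<alpha> \<beta> \<le> -1"
    using assms copair_root_Ints Ints_neg_le_minus_1 by blast+
  show ?thesis
  proof (cases "norm \<beta> \<le> norm \<alpha>")
    case True
    then have "copair \<beta> \<alpha> = -1"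
      using copair_ge_minus_1_if_shorter assms le by fastforce
    then show ?thesis
      using reflection_root[OF assms(1,2)] by (simp add: reflection_def add.commute)
  next
    case False
    moreover have "\<alpha> \<noteq> - \<beta>" using assms(4) by auto
    ultimately have "copair \<alpha> \<beta> = -1"
      using copair_ge_minus_1_if_shorter[OF assms(2,1)] le by fastforce
    then show ?thesis
      using reflection_root[OF assms(2,1)] by (simp add: reflection_def)
  qed
qed

lemma open_regular: "open (UNIV - (\<Union>\<alpha>\<in>\<Delta>. {v. \<alpha> \<bullet> v = 0}))"
  by (intro open_Diff open_UNIV closed_UN finite_roots ballI closed_hyperplane)

text \<open>The reflection is a continuous involution of the complement of the root hyperplanes, so
  it permutes the components. Maximality is checked by pulling a larger connected set back to
  \<open>\<sigma>\<close>.\<close>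

lemma reflection_chamber:
  assumes \<alpha>: "\<alpha> \<in> \<Delta>" and "\<sigma> \<in> chambers \<Delta>"
  shows "reflection \<alpha> ` \<sigma> \<in> chambers \<Delta>"
proof -
  let ?R = "UNIV - (\<Union>\<alpha>\<in>\<Delta>. {v. \<alpha> \<bullet> v = 0})"
  have nz: "\<alpha> \<noteq> 0" using \<alpha> root_nonzero by blast
  have reg: "reflection \<alpha> v \<in> ?R" if "v \<in> ?R" for v
    using that reflection_root[OF \<alpha>] by (auto simp flip: inner_reflection[OF nz])
  have cont: "continuous_on S (reflection \<alpha>)" for S
    by (simp add: linear_continuous_on linear_reflection linear_linear)
  have inv: "reflection \<alpha> ` reflection \<alpha> ` S = S" for S
    using reflection_reflection[OF nz] by (simp add: image_comp)
  have \<sigma>: "\<sigma> \<subseteq> ?R" "\<sigma> \<noteq> {}" "connected \<sigma>"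
    and max: "\<And>d. d \<noteq> {} \<Longrightarrow> d \<subseteq> ?R \<Longrightarrow> \<sigma> \<subseteq> d \<Longrightarrow> connected d \<Longrightarrow> d = \<sigma>"
    using assms(2) unfolding chambers_def in_components_maximal by auto
  show ?thesis
    unfolding chambers_def in_components_maximal
  proof (intro conjI allI impI)
    show "reflection \<alpha> ` \<sigma> \<subseteq> ?R" using \<sigma> reg by blast
    show "reflection \<alpha> ` \<sigma> \<noteq> {}" using \<sigma> by blast
    show "connected (reflection \<alpha> ` \<sigma>)" using \<sigma> cont connected_continuous_image by blast
    fix d assume d: "d \<noteq> {} \<and> reflection \<alpha> ` \<sigma> \<subseteq> d \<and> d \<subseteq> ?R \<and> connected d"
    then have "reflection \<alpha> ` d = \<sigma>"
      using reg image_mono[of "reflection \<alpha> ` \<sigma>" d "reflection \<alpha>", unfolded inv]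
        connected_continuous_image[OF cont, of d]
      by (intro max) auto
    then show "d = reflection \<alpha> ` \<sigma>" using inv by metis
  qed
qed

end


text \<open>The chamber is a locale parameter because the same theory is interpreted again at every
  chamber met on a walk away from the dominant one.\<close>

locale chamber_base = reduced_root_system +
  fixes C
  assumes chamber: "C \<in> chambers \<Delta>"
begin

abbreviation "Pos \<equiv> positive_roots \<Delta> C"
abbreviation "B \<equiv> simple_roots \<Delta> C"

lemma chamber_nonempty: "C \<noteq> {}"
  and chamber_connected: "connected C"
  and chamber_regular: "v \<in> C \<Longrightarrow> \<alpha> \<in> \<Delta> \<Longrightarrow> \<alpha> \<bullet> v \<noteq> 0"
  using chamber in_components_nonempty in_components_connected in_components_subset
  unfolding chambers_def by blast+

lemma open_chamber: "open C"
  using chamber open_components open_regular unfolding chambers_def by blast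

lemma Pos_root: "\<alpha> \<in> Pos \<Longrightarrow> \<alpha> \<in> \<Delta>"
  and finite_Pos: "finite Pos" and Pos_inner: "\<alpha> \<in> Pos \<Longrightarrow> v \<in> C \<Longrightarrow> \<alpha> \<bullet> v > 0"
  using finite_roots by (auto simp: positive_roots_def)

lemma simple_pos: "\<alpha> \<in> B \<Longrightarrow> \<alpha> \<in> Pos" and simple_root: "\<alpha> \<in> B \<Longrightarrow> \<alpha> \<in> \<Delta>"
  and simple_nonzero: "\<alpha> \<in> B \<Longrightarrow> \<alpha> \<noteq> 0" and Pos_nonzero: "\<alpha> \<in> Pos \<Longrightarrow> \<alpha> \<noteq> 0"
  using root_nonzero by (auto simp: positive_roots_def simple_roots_def)

lemma simple_indecomposable: "\<beta> + \<gamma> \<in> B \<Longrightarrow> \<beta> \<in> Pos \<Longrightarrow> \<gamma> \<notin> Pos"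
  unfolding simple_roots_def by blast

lemma finite_simple: "finite B"
  using finite_Pos by (simp add: simple_roots_def)

text \<open>\<open>C\<close> is connected and avoids all root hyperplanes, so a root keeps its sign
  on it and one point decides.\<close>

lemma Pos_iff:
  assumes "v \<in> C"
  shows "\<alpha> \<in> Pos \<longleftrightarrow> \<alpha> \<in> \<Delta> \<and> \<alpha> \<bullet> v > 0"
proof -
  have "\<alpha> \<bullet> w > 0" if \<alpha>: "\<alpha> \<in> \<Delta>" "\<alpha> \<bullet> v > 0" and w: "w \<in> C" for w
  proof (rule ccontr)
    assume "\<not> \<alpha> \<bullet> w > 0"
    then obtain z where "z \<in> C" "\<alpha> \<bullet> z = 0"
      using connected_ivt_hyperplane[OF chamber_connected w assms, of \<alpha> 0] \<alpha>(2)
      by (meson less_imp_le not_less)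
    then show False using chamber_regular \<alpha>(1) by blast
  qed
  then show ?thesis using assms by (auto simp: positive_roots_def)
qed

lemma Pos_or_minus_Pos:
  assumes "\<alpha> \<in> \<Delta>"
  shows "\<alpha> \<in> Pos \<or> - \<alpha> \<in> Pos"
proof -
  obtain v where v: "v \<in> C" using chamber_nonempty by blast
  then show ?thesis
    using chamber_regular[OF v assms] minus_root assms by (auto simp: Pos_iff[OF v])
qed

lemma minus_Pos: "\<alpha> \<in> Pos \<Longrightarrow> - \<alpha> \<notin> Pos"
  using chamber_nonempty Pos_inner by (metis all_not_in_conv inner_minus_left neg_0_less_iff_less order_less_asym)

lemma convex_positive_set: "convex {v. \<forall>\<alpha>\<in>Pos. \<alpha> \<bullet> v > 0}"
proof -
  have "{v. \<forall>\<alpha>\<in>Pos. \<alpha> \<bullet> v > 0} = (\<Inter>\<alpha>\<in>Pos. {v. \<alpha> \<bullet> v > 0})" by auto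
  then show ?thesis by (simp add: convex_INT convex_halfspace_gt)
qed

text \<open>The right side is convex, hence connected, avoids all root hyperplanes and meets
  \<open>C\<close>, so it lies in the same component.\<close>

lemma chamber_eq: "C = {v. \<forall>\<alpha>\<in>Pos. \<alpha> \<bullet> v > 0}"
proof
  show "C \<subseteq> {v. \<forall>\<alpha>\<in>Pos. \<alpha> \<bullet> v > 0}" using Pos_inner by blast
  have "connected {v. \<forall>\<alpha>\<in>Pos. \<alpha> \<bullet> v > 0}" by (rule convex_connected[OF convex_positive_set])
  moreover have "{v. \<forall>\<alpha>\<in>Pos. \<alpha> \<bullet> v > 0} \<subseteq> UNIV - (\<Union>\<alpha>\<in>\<Delta>. {v. \<alpha> \<bullet> v = 0})"
    using Pos_or_minus_Pos by force
  moreover have "C \<inter> {v. \<forall>\<alpha>\<in>Pos. \<alpha> \<bullet> v > 0} \<noteq> {}"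
    using chamber_nonempty Pos_inner by blast
  ultimately show "{v. \<forall>\<alpha>\<in>Pos. \<alpha> \<bullet> v > 0} \<subseteq> C"
    using components_maximal chamber unfolding chambers_def by blast
qed

lemma convex_chamber: "convex C"
  by (subst chamber_eq) (rule convex_positive_set)

lemma mem_chamber_iff: "v \<in> C \<longleftrightarrow> (\<forall>\<alpha>\<in>Pos. \<alpha> \<bullet> v > 0)"
  by (subst chamber_eq) simp

lemma closure_chamber: "closure C = {v. \<forall>\<alpha>\<in>Pos. \<alpha> \<bullet> v \<ge> 0}"
proof
  have "{v. \<forall>\<alpha>\<in>Pos. \<alpha> \<bullet> v \<ge> 0} = (\<Inter>\<alpha>\<in>Pos. {v. \<alpha> \<bullet> v \<ge> 0})" by auto
  then have "closed {v. \<forall>\<alpha>\<in>Pos. \<alpha> \<bullet> v \<ge> 0}"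
    by (simp add: closed_INT closed_halfspace_ge)
  then show "closure C \<subseteq> {v. \<forall>\<alpha>\<in>Pos. \<alpha> \<bullet> v \<ge> 0}"
    using Pos_inner by (intro closure_minimal) (auto intro: less_imp_le)
  show "{v. \<forall>\<alpha>\<in>Pos. \<alpha> \<bullet> v \<ge> 0} \<subseteq> closure C"
  proof
    fix v assume v: "v \<in> {v. \<forall>\<alpha>\<in>Pos. \<alpha> \<bullet> v \<ge> 0}"
    obtain v0 where v0: "v0 \<in> C" using chamber_nonempty by blast
    \<comment> \<open>Adding a small multiple of a chamber point makes the weak inequalities strict,
      and these points tend to \<open>v\<close>.\<close>
    have "v + (1 / real (Suc n)) *\<^sub>R v0 \<in> C" for n
      using v Pos_inner[OF _ v0]
      by (auto simp: mem_chamber_iff inner_add_right simp del: of_nat_Suc intro!: add_nonneg_pos)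
    moreover have "(\<lambda>n. v + (1 / real (Suc n)) *\<^sub>R v0) \<longlonglongrightarrow> v + 0 *\<^sub>R v0"
      by (intro tendsto_intros LIMSEQ_Suc[OF lim_1_over_n])
    ultimately show "v \<in> closure C"
      unfolding closure_sequential
      by (auto intro!: exI[of _ "\<lambda>n. v + (1 / real (Suc n)) *\<^sub>R v0"] simp del: of_nat_Suc)
  qed
qed

text \<open>A positive root that is not simple splits into two positive roots, both with a smaller
  value at a fixed point of \<open>C\<close>; the induction counts the positive roots of smaller
  value.\<close>

lemma Pos_nat_combination:
  assumes "\<gamma> \<in> Pos"
  shows "\<exists>n :: 'a \<Rightarrow> nat. \<gamma> = (\<Sum>\<beta>\<in>B. real (n \<beta>) *\<^sub>R \<beta>)"
proof -
  obtain v where v: "v \<in> C" using chamber_nonempty by blast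
  show ?thesis
    using assms
  proof (induction "card {\<delta>\<in>Pos. \<delta> \<bullet> v < \<gamma> \<bullet> v}" arbitrary: \<gamma> rule: less_induct)
    case less
    show ?case
    proof (cases "\<gamma> \<in> B")
      case True
      have "\<gamma> = (\<Sum>\<beta>\<in>B. real (if \<beta> = \<gamma> then 1 else 0) *\<^sub>R \<beta>)"
        using True finite_simple
        by (simp add: if_distrib[of real] if_distrib[of "\<lambda>c. c *\<^sub>R _"] cong: if_cong)
      then show ?thesis by (rule exI[of _ "\<lambda>\<beta>. if \<beta> = \<gamma> then 1 else 0"])
    next
      case False
      then obtain \<beta> \<delta> where *: "\<beta> \<in> Pos" "\<delta> \<in> Pos" "\<gamma> = \<beta> + \<delta>"
        using less.prems by (auto simp: simple_roots_def)
      have "\<exists>n :: 'a \<Rightarrow> nat. \<eta> = (\<Sum>\<beta>\<in>B. real (n \<beta>) *\<^sub>R \<beta>)" if "\<eta> \<in> {\<beta>, \<delta>}" for \<eta>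
      proof -
        have "\<eta> \<in> Pos" "\<eta> \<bullet> v < \<gamma> \<bullet> v"
          using that * Pos_inner[OF _ v] by (auto simp: inner_add_left)
        then have "{\<zeta>\<in>Pos. \<zeta> \<bullet> v < \<eta> \<bullet> v} \<subset> {\<zeta>\<in>Pos. \<zeta> \<bullet> v < \<gamma> \<bullet> v}" by auto
        then show ?thesis
          using finite_Pos \<open>\<eta> \<in> Pos\<close> by (intro less.hyps psubset_card_mono) auto
      qed
      then obtain n k :: "'a \<Rightarrow> nat"
        where "\<beta> = (\<Sum>\<beta>\<in>B. real (n \<beta>) *\<^sub>R \<beta>)" "\<delta> = (\<Sum>\<beta>\<in>B. real (k \<beta>) *\<^sub>R \<beta>)" by blast
      then have "\<gamma> = (\<Sum>\<beta>\<in>B. real (n \<beta> + k \<beta>) *\<^sub>R \<beta>)"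
        using * by (simp add: scaleR_add_left sum.distrib)
      then show ?thesis by (rule exI[of _ "\<lambda>\<beta>. n \<beta> + k \<beta>"])
    qed
  qed
qed

text \<open>Otherwise the difference of the two is a root, and whichever sign of it is positive
  decomposes one of them.\<close>

lemma simple_obtuse:
  assumes "\<alpha> \<in> B" "\<beta> \<in> B" "\<alpha> \<noteq> \<beta>"
  shows "\<alpha> \<bullet> \<beta> \<le> 0"
proof (rule ccontr)
  assume "\<not> \<alpha> \<bullet> \<beta> \<le> 0"
  then have "copair \<alpha> \<beta> > 0" using copair_pos_iff[OF simple_nonzero[OF assms(2)]] by simp
  then have "- \<beta> + \<alpha> \<in> \<Delta>"
    using add_root_if_copair_neg[of "- \<beta>" \<alpha>] assms simple_root minus_root by (auto simp: copair_minus_right)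
  then consider "\<alpha> - \<beta> \<in> Pos" | "\<beta> - \<alpha> \<in> Pos"
    using Pos_or_minus_Pos[of "- \<beta> + \<alpha>"] by auto
  then show False
    using simple_indecomposable[of "\<alpha> - \<beta>" \<beta>] simple_indecomposable[of "\<beta> - \<alpha>" \<alpha>] assms simple_pos
    by cases auto
qed

text \<open>A relation splits into its positive and negative parts \<open>p = q\<close>, which have
  disjoint supports. Obtuseness gives \<open>p \<bullet> q \<le> 0\<close>, so both vanish; pairing
  with a point of the chamber, where simple roots are positive, then kills every
  coefficient.\<close>

lemma independent_simple: "independent B"
proof
  assume "dependent B"
  then obtain u \<beta> where u: "\<beta> \<in> B" "u \<beta> \<noteq> 0" "(\<Sum>v\<in>B. u v *\<^sub>R v) = 0"
    using finite_simple by (auto simp: dependent_finite)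
  obtain v where v: "v \<in> C" using chamber_nonempty by blast
  define p where "p = (\<Sum>\<beta>\<in>B. max (u \<beta>) 0 *\<^sub>R \<beta>)"
  define q where "q = (\<Sum>\<beta>\<in>B. max (- u \<beta>) 0 *\<^sub>R \<beta>)"
  have "p - q = (\<Sum>v\<in>B. u v *\<^sub>R v)"
    unfolding p_def q_def sum_subtractf[symmetric] scaleR_diff_left[symmetric]
    by (intro sum.cong) (auto simp: max_def)
  then have "p = q" using u by simp
  have "p \<bullet> q \<le> 0"
    unfolding p_def q_def inner_sum_left inner_sum_right
  proof (intro sum_nonpos)
    fix \<alpha> \<beta> assume "\<alpha> \<in> B" "\<beta> \<in> B"
    then show "max (u \<alpha>) 0 *\<^sub>R \<alpha> \<bullet> max (- u \<beta>) 0 *\<^sub>R \<beta> \<le> 0"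
      using simple_obtuse[of \<alpha> \<beta>] by (cases "\<alpha> = \<beta>") (auto simp: max_def mult_le_0_iff zero_le_mult_iff)
  qed
  with \<open>p = q\<close> have 0: "p = 0" "q = 0" using inner_gt_zero_iff[of p] by fastforce+
  have "max (u \<beta>) 0 * (\<beta> \<bullet> v) = 0 \<and> max (- u \<beta>) 0 * (\<beta> \<bullet> v) = 0"
  proof -
    have "p \<bullet> v = 0" "q \<bullet> v = 0" using 0 by simp_all
    then have "(\<Sum>\<beta>\<in>B. max (u \<beta>) 0 * (\<beta> \<bullet> v)) = 0" "(\<Sum>\<beta>\<in>B. max (- u \<beta>) 0 * (\<beta> \<bullet> v)) = 0"
      by (simp_all add: p_def q_def inner_sum_left)
    moreover have "\<beta> \<bullet> v \<ge> 0" if "\<beta> \<in> B" for \<beta> using Pos_inner[OF simple_pos[OF that] v] by simp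
    ultimately show ?thesis
      using u(1) finite_simple
        sum_nonneg_0[of B "\<lambda>\<beta>. max (u \<beta>) 0 * (\<beta> \<bullet> v)" \<beta>]
        sum_nonneg_0[of B "\<lambda>\<beta>. max (- u \<beta>) 0 * (\<beta> \<bullet> v)" \<beta>] by auto
  qed
  then show False
    using u Pos_inner[OF simple_pos[OF u(1)] v] by (auto simp: max_def split: if_splits)
qed

lemma span_simple: "span B = UNIV"
proof -
  have "\<gamma> \<in> span B" if \<gamma>: "\<gamma> \<in> Pos" for \<gamma>
  proof -
    obtain n :: "'a \<Rightarrow> nat" where "\<gamma> = (\<Sum>\<beta>\<in>B. real (n \<beta>) *\<^sub>R \<beta>)"
      using Pos_nat_combination[OF \<gamma>] by blast
    then show ?thesis by (simp add: span_sum span_scale span_base)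
  qed
  then have "\<Delta> \<subseteq> span B"
    using Pos_or_minus_Pos by (metis add.inverse_inverse span_neg subsetI)
  then show ?thesis using span_minimal[OF _ subspace_span] span_roots by blast
qed

section \<open>Coordinates in the basis of simple roots\<close>

definition coord :: "'a \<Rightarrow> 'a \<Rightarrow> real" where
  "coord \<beta> x = representation B x \<beta>"

lemma coord_add: "coord \<beta> (x + y) = coord \<beta> x + coord \<beta> y"
  and coord_diff: "coord \<beta> (x - y) = coord \<beta> x - coord \<beta> y"
  and coord_minus: "coord \<beta> (- x) = - coord \<beta> x"
  and coord_scaleR: "coord \<beta> (c *\<^sub>R x) = c * coord \<beta> x"
  and coord_zero: "coord \<beta> 0 = 0"
  by (simp_all add: coord_def independent_simple span_simple real_vector.representation_add
      real_vector.representation_diff real_vector.representation_neg real_vector.representation_scale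
      real_vector.representation_zero)

lemma coord_sum: "coord \<beta> (sum f A) = (\<Sum>a\<in>A. coord \<beta> (f a))"
  by (induction A rule: infinite_finite_induct) (simp_all add: coord_zero coord_add)

lemma coord_simple: "\<gamma> \<in> B \<Longrightarrow> coord \<beta> \<gamma> = (if \<beta> = \<gamma> then 1 else 0)"
  by (simp add: coord_def independent_simple real_vector.representation_basis)

lemma coord_expand: "x = (\<Sum>\<beta>\<in>B. coord \<beta> x *\<^sub>R \<beta>)"
  using real_vector.sum_representation_eq[OF independent_simple, of x B] finite_simple
  by (simp add: coord_def span_simple)

lemma coord_combination: "\<beta> \<in> B \<Longrightarrow> coord \<beta> (\<Sum>\<gamma>\<in>B. c \<gamma> *\<^sub>R \<gamma>) = c \<beta>"
  using finite_simple by (simp add: coord_sum coord_scaleR coord_simple if_distrib cong: if_cong)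

lemma coord_eqI: "(\<And>\<beta>. \<beta> \<in> B \<Longrightarrow> coord \<beta> x = coord \<beta> y) \<Longrightarrow> x = y"
  using coord_expand[of x] coord_expand[of y] by simp

lemma coord_Pos_Nats: "\<gamma> \<in> Pos \<Longrightarrow> \<beta> \<in> B \<Longrightarrow> coord \<beta> \<gamma> \<in> \<nat>"
  using Pos_nat_combination[of \<gamma>] coord_combination by auto

lemma coord_root_Ints: "\<gamma> \<in> \<Delta> \<Longrightarrow> \<beta> \<in> B \<Longrightarrow> coord \<beta> \<gamma> \<in> \<int>"
  using Pos_or_minus_Pos[of \<gamma>] coord_Pos_Nats Nats_subset_Ints coord_minus
  by (metis Ints_minus add.inverse_inverse subsetD)

lemma inner_coord_expand: "x \<bullet> y = (\<Sum>\<beta>\<in>B. coord \<beta> y * (x \<bullet> \<beta>))"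
  by (subst coord_expand[of y]) (simp add: inner_sum_right)

lemma copair_coord_expand: "copair x \<alpha> = (\<Sum>\<beta>\<in>B. coord \<beta> x * copair \<beta> \<alpha>)"
  by (subst coord_expand[of x]) (simp add: copair_sum copair_scaleR)

lemma root_lattice_iff: "x \<in> root_lattice \<Delta> \<longleftrightarrow> (\<forall>\<beta>\<in>B. coord \<beta> x \<in> \<int>)"
proof
  assume "x \<in> root_lattice \<Delta>"
  then show "\<forall>\<beta>\<in>B. coord \<beta> x \<in> \<int>"
    using coord_root_Ints by (auto simp: root_lattice_def coord_sum coord_scaleR intro!: Ints_sum Ints_mult)
next
  assume *: "\<forall>\<beta>\<in>B. coord \<beta> x \<in> \<int>"
  \<comment> \<open>The remaining roots get coefficient 0; on simple roots the floor only turns an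
    integral real into an \<open>int\<close>.\<close>
  have "(\<Sum>\<alpha>\<in>\<Delta>. of_int (if \<alpha> \<in> B then \<lfloor>coord \<alpha> x\<rfloor> else 0) *\<^sub>R \<alpha>) = (\<Sum>\<alpha>\<in>B. coord \<alpha> x *\<^sub>R \<alpha>)"
    using * finite_roots simple_root by (intro sum.mono_neutral_cong_right) auto
  then have "x = (\<Sum>\<alpha>\<in>\<Delta>. of_int (if \<alpha> \<in> B then \<lfloor>coord \<alpha> x\<rfloor> else 0) *\<^sub>R \<alpha>)"
    using coord_expand[of x] by simp
  then show "x \<in> root_lattice \<Delta>" unfolding root_lattice_def by (auto intro!: exI[of _ "\<lambda>\<alpha>. if \<alpha> \<in> B then \<lfloor>coord \<alpha> x\<rfloor> else 0"])
qed

text \<open>The reflection changes only the \<open>\<alpha>\<close>-coordinate. If the image were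
  negative, all other coordinates of \<open>\<gamma>\<close> would vanish, and reducedness would
  give \<open>\<gamma> = \<alpha>\<close>.\<close>

lemma reflection_simple_Pos:
  assumes "\<alpha> \<in> B" "\<gamma> \<in> Pos" "\<gamma> \<noteq> \<alpha>"
  shows "reflection \<alpha> \<gamma> \<in> Pos"
proof (rule ccontr)
  assume "reflection \<alpha> \<gamma> \<notin> Pos"
  then have neg: "- reflection \<alpha> \<gamma> \<in> Pos"
    using Pos_or_minus_Pos reflection_root assms simple_root Pos_root by blast
  have "coord \<beta> \<gamma> = 0" if "\<beta> \<in> B" "\<beta> \<noteq> \<alpha>" for \<beta>
  proof -
    have "coord \<beta> (- reflection \<alpha> \<gamma>) = - coord \<beta> \<gamma>"
      using that assms by (simp add: reflection_def coord_minus coord_diff coord_scaleR coord_simple)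
    then show ?thesis
      using coord_Pos_Nats[OF assms(2) that(1)] coord_Pos_Nats[OF neg that(1)] by (auto simp: Nats_iff_nonneg_Ints)
  qed
  then have eq: "\<gamma> = coord \<alpha> \<gamma> *\<^sub>R \<alpha>"
    using assms by (intro coord_eqI) (auto simp: coord_scaleR coord_simple)
  have "coord \<alpha> \<gamma> *\<^sub>R \<alpha> \<in> \<Delta>" using Pos_root[OF assms(2)] by (subst eq[symmetric])
  then have "coord \<alpha> \<gamma> = 1 \<or> coord \<alpha> \<gamma> = -1"
    using proportional_roots[OF simple_root[OF assms(1)]] by blast
  moreover have "coord \<alpha> \<gamma> \<ge> 0"
    using coord_Pos_Nats[OF assms(2,1)] by (simp add: Nats_iff_nonneg_Ints)
  ultimately have "coord \<alpha> \<gamma> = 1" by linarith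
  with eq assms(3) show False by (metis scaleR_one)
qed

subsection \<open>The numbers game and the dominance order\<close>

lemma weight_lattice_Ints: "x \<in> weight_lattice \<Delta> \<Longrightarrow> \<alpha> \<in> \<Delta> \<Longrightarrow> copair x \<alpha> \<in> \<int>"
  by (simp add: weight_lattice_def)

lemma weight_lattice_add: "x \<in> weight_lattice \<Delta> \<Longrightarrow> y \<in> weight_lattice \<Delta> \<Longrightarrow> x + y \<in> weight_lattice \<Delta>"
  and weight_lattice_diff: "x \<in> weight_lattice \<Delta> \<Longrightarrow> y \<in> weight_lattice \<Delta> \<Longrightarrow> x - y \<in> weight_lattice \<Delta>"
  and root_weight_lattice: "\<alpha> \<in> \<Delta> \<Longrightarrow> \<alpha> \<in> weight_lattice \<Delta>"
  using copair_root_Ints by (auto simp: weight_lattice_def copair_add copair_diff)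

definition almost_dominant :: "'a \<Rightarrow> bool" where
  "almost_dominant w \<longleftrightarrow> w \<in> weight_lattice \<Delta> \<and> (\<forall>\<gamma>\<in>Pos. copair w \<gamma> \<ge> -1)"

text \<open>The dominance order. Natural coordinates encode at once that the difference lies in the
  root lattice and in the cone of the simple roots.\<close>

definition below :: "'a \<Rightarrow> 'a \<Rightarrow> bool" where
  "below w \<nu> \<longleftrightarrow> (\<forall>\<beta>\<in>B. coord \<beta> (\<nu> - w) \<in> \<nat>)"

lemma belowD: "below w \<nu> \<Longrightarrow> \<beta> \<in> B \<Longrightarrow> coord \<beta> (\<nu> - w) \<ge> 0"
  by (auto simp: below_def Nats_iff_nonneg_Ints)

lemma almost_dominantD: "almost_dominant w \<Longrightarrow> \<gamma> \<in> Pos \<Longrightarrow> copair w \<gamma> \<ge> -1"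
  and almost_dominant_weight: "almost_dominant w \<Longrightarrow> w \<in> weight_lattice \<Delta>"
  by (simp_all add: almost_dominant_def)

text \<open>\<open>copair\<close> is not additive in its second argument, so the sign is computed
  with the inner product, which is.\<close>

lemma dominant_copair_Pos:
  assumes "dominant_for \<Delta> C y" "\<gamma> \<in> Pos"
  shows "copair y \<gamma> \<ge> 0"
proof -
  have "0 \<le> coord \<beta> \<gamma> * (y \<bullet> \<beta>)" if "\<beta> \<in> B" for \<beta>
    using assms that coord_Pos_Nats[OF assms(2) that] copair_nonneg_iff[OF simple_nonzero[OF that]]
    by (auto simp: dominant_for_def Nats_iff_nonneg_Ints)
  then have "y \<bullet> \<gamma> \<ge> 0"
    by (subst inner_coord_expand) (rule sum_nonneg)
  then show ?thesis using copair_nonneg_iff Pos_nonzero assms by blast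
qed

lemma dominant_almost_dominant:
  "y \<in> weight_lattice \<Delta> \<Longrightarrow> dominant_for \<Delta> C y \<Longrightarrow> almost_dominant y"
  using dominant_copair_Pos by (force simp: almost_dominant_def)

text \<open>\<open>w - \<alpha>\<close> lies on the segment from \<open>w\<close> to \<open>s\<^sub>\<alpha> w\<close>, and \<open>s\<^sub>\<alpha>\<close> permutes the positive
  roots other than \<open>\<alpha>\<close>.\<close>
lemma almost_dominant_lower:
  assumes w: "almost_dominant w" and \<alpha>: "\<alpha> \<in> B" and k: "copair w \<alpha> \<ge> 1"
  shows "almost_dominant (w - \<alpha>)"
  unfolding almost_dominant_def
proof (intro conjI ballI)
  show "w - \<alpha> \<in> weight_lattice \<Delta>"
    using w \<alpha> weight_lattice_diff root_weight_lattice simple_root almost_dominant_weight by blast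
  fix \<gamma> assume \<gamma>: "\<gamma> \<in> Pos"
  show "copair (w - \<alpha>) \<gamma> \<ge> -1"
  proof (cases "\<gamma> = \<alpha>")
    case True
    then show ?thesis using k copair_self[OF simple_nonzero[OF \<alpha>]] by (simp add: copair_diff)
  next
    case False
    have "copair (reflection \<alpha> w) \<gamma> \<ge> -1"
      using almost_dominantD[OF w reflection_simple_Pos[OF \<alpha> \<gamma> False]]
      by (simp add: copair_reflection[OF simple_nonzero[OF \<alpha>]])
    then have "copair w \<gamma> - copair w \<alpha> * copair \<alpha> \<gamma> \<ge> -1"
      by (simp add: reflection_def copair_diff copair_scaleR)
    moreover have "copair \<alpha> \<gamma> \<le> copair w \<alpha> * copair \<alpha> \<gamma>" if "copair \<alpha> \<gamma> \<ge> 0"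
      using mult_right_mono[OF k that] by simp
    ultimately show ?thesis
      using almost_dominantD[OF w \<gamma>] by (cases "copair \<alpha> \<gamma> \<ge> 0") (auto simp: copair_diff)
  qed
qed

text \<open>Integrality leaves -1 as the only possible negative pairing, so adding
  \<open>\<alpha>\<close> is a reflection. It permutes the other positive roots, and at
  \<open>\<alpha>\<close> the pairing becomes 1.\<close>

lemma almost_dominant_raise:
  assumes w: "almost_dominant w" and \<alpha>: "\<alpha> \<in> B" and k: "copair w \<alpha> < 0"
  shows "copair w \<alpha> = -1" "w + \<alpha> = reflection \<alpha> w" "almost_dominant (w + \<alpha>)"
proof -
  show eq: "copair w \<alpha> = -1"
    using almost_dominantD[OF w simple_pos[OF \<alpha>]] k Ints_neg_le_minus_1
      weight_lattice_Ints[OF almost_dominant_weight[OF w] simple_root[OF \<alpha>]] by force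
  show refl: "w + \<alpha> = reflection \<alpha> w" by (simp add: reflection_def eq)
  have "copair (w + \<alpha>) \<gamma> \<ge> -1" if "\<gamma> \<in> Pos" for \<gamma>
  proof (cases "\<gamma> = \<alpha>")
    case True
    then show ?thesis using eq copair_self[OF simple_nonzero[OF \<alpha>]] by (simp add: copair_add)
  next
    case False
    then show ?thesis
      using almost_dominantD[OF w reflection_simple_Pos[OF \<alpha> that False]]
      by (simp add: refl copair_reflection[OF simple_nonzero[OF \<alpha>]])
  qed
  then show "almost_dominant (w + \<alpha>)"
    using w \<alpha> weight_lattice_add root_weight_lattice simple_root almost_dominant_weight
    by (auto simp: almost_dominant_def)
qed

section \<open>Winning positions of the numbers game\<close>

lemma almost_dominant_allowed: "almost_dominant w \<Longrightarrow> allowed \<Delta> C w"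
  using simple_pos by (auto simp: almost_dominant_def allowed_def)

text \<open>The play is read backwards from its dominant end: undoing a move is lowering by a simple
  root whose pairing is 1.\<close>

lemma winning_imp_almost_dominant:
  assumes "winning \<Delta> C x"
  shows "almost_dominant x"
proof -
  obtain y where "(\<lambda>u w. game_move \<Delta> C u w \<and> allowed \<Delta> C w)\<^sup>*\<^sup>* x y" "dominant_for \<Delta> C y" "allowed \<Delta> C x"
    using assms by (auto simp: winning_def)
  then show ?thesis
  proof (induction rule: converse_rtranclp_induct)
    case base
    then show ?case using dominant_almost_dominant by (simp add: allowed_def)
  next
    case (step u w)
    then obtain \<alpha> where \<alpha>: "\<alpha> \<in> B" "copair u \<alpha> < 0" "w = u - copair u \<alpha> *\<^sub>R \<alpha>"
      by (auto simp: game_move_def)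
    have "copair u \<alpha> = -1"
      using step.prems \<alpha> Ints_neg_le_minus_1[of "copair u \<alpha>"] simple_root[OF \<alpha>(1)]
      by (auto simp: allowed_def weight_lattice_def intro: antisym)
    then have w: "w = u + \<alpha>" using \<alpha> by simp
    have "copair w \<alpha> = 1"
      using \<open>copair u \<alpha> = -1\<close> copair_self[OF simple_nonzero[OF \<alpha>(1)]] by (simp add: w copair_add)
    then have "almost_dominant (w - \<alpha>)"
      using almost_dominant_lower[of w \<alpha>] step \<alpha>(1) by auto
    then show ?case by (simp add: w)
  qed
qed

text \<open>Any available move works. It preserves almost dominance and lowers the number of
  positive roots with negative pairing, because \<open>reflection \<alpha>\<close> injects those of
  the new position into those of the old one other than \<open>\<alpha>\<close>.\<close>

lemma almost_dominant_imp_winning: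
  assumes "almost_dominant x"
  shows "winning \<Delta> C x"
  using assms
proof (induction "card {\<gamma>\<in>Pos. copair x \<gamma> < 0}" arbitrary: x rule: less_induct)
  case less
  note allowed = almost_dominant_allowed[OF less.prems]
  show ?case
  proof (cases "dominant_for \<Delta> C x")
    case True
    then show ?thesis using allowed by (auto simp: winning_def)
  next
    case False
    then obtain \<alpha> where \<alpha>: "\<alpha> \<in> B" "copair x \<alpha> < 0" by (auto simp: dominant_for_def not_le)
    note raise = almost_dominant_raise[OF less.prems \<alpha>] and nz = simple_nonzero[OF \<alpha>(1)]
    let ?N = "\<lambda>x. {\<gamma>\<in>Pos. copair x \<gamma> < 0}"
    have "reflection \<alpha> ` ?N (x + \<alpha>) \<subseteq> ?N x - {\<alpha>}"
    proof
      fix \<delta> assume "\<delta> \<in> reflection \<alpha> ` ?N (x + \<alpha>)"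
      then obtain \<gamma> where \<gamma>: "\<gamma> \<in> Pos" "copair (x + \<alpha>) \<gamma> < 0" "\<delta> = reflection \<alpha> \<gamma>" by blast
      have "\<gamma> \<noteq> \<alpha>" using \<gamma>(2) raise(1) copair_self[OF nz] by (auto simp: copair_add)
      moreover have "copair x \<delta> < 0"
        using \<gamma> raise(2) by (simp add: copair_reflection[OF nz])
      moreover have "\<delta> \<noteq> \<alpha>"
        using \<gamma> reflection_reflection[OF nz, of \<gamma>] reflection_self[OF nz] minus_Pos simple_pos[OF \<alpha>(1)] by metis
      ultimately show "\<delta> \<in> ?N x - {\<alpha>}"
        using \<gamma> reflection_simple_Pos[OF \<alpha>(1)] by blast
    qed
    moreover have "card (reflection \<alpha> ` ?N (x + \<alpha>)) = card (?N (x + \<alpha>))"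
      using inj_reflection[OF nz] by (intro card_image) (auto simp: inj_on_def)
    moreover have "?N x - {\<alpha>} \<subset> ?N x" using \<alpha> simple_pos by auto
    ultimately have "card (?N (x + \<alpha>)) < card (?N x)"
      using finite_Pos card_mono[of "?N x - {\<alpha>}" "reflection \<alpha> ` ?N (x + \<alpha>)"]
        psubset_card_mono[of "?N x" "?N x - {\<alpha>}"] by simp
    then have "winning \<Delta> C (x + \<alpha>)" using less.hyps raise(3) by blast
    moreover have "game_move \<Delta> C x (x + \<alpha>)"
      using allowed \<alpha> raise(1) by (auto simp: game_move_def intro!: bexI[of _ \<alpha>])
    ultimately show ?thesis
      using allowed unfolding winning_def
      by (auto intro: converse_rtranclp_into_rtranclp[of "\<lambda>u w. game_move \<Delta> C u w \<and> allowed \<Delta> C w"])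
  qed
qed

lemma winning_iff: "winning \<Delta> C x \<longleftrightarrow> almost_dominant x"
  using winning_imp_almost_dominant almost_dominant_imp_winning by blast

section \<open>The dominance order under moves\<close>

lemma copair_simple_nonpos: "\<alpha> \<in> B \<Longrightarrow> \<beta> \<in> B \<Longrightarrow> \<beta> \<noteq> \<alpha> \<Longrightarrow> copair \<beta> \<alpha> \<le> 0"
  using simple_obtuse copair_pos_iff[OF simple_nonzero] by (meson not_le)

lemma below_add_if_coord_pos:
  assumes w: "below w \<nu>" and \<alpha>: "\<alpha> \<in> B" "coord \<alpha> (\<nu> - w) > 0"
  shows "below (w + \<alpha>) \<nu>"
proof -
  have "coord \<alpha> (\<nu> - w) \<ge> 1"
    using w \<alpha> Ints_pos_ge_1 by (auto simp: below_def Nats_iff_nonneg_Ints)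
  moreover have "coord \<beta> (\<nu> - (w + \<alpha>)) = coord \<beta> (\<nu> - w) - (if \<beta> = \<alpha> then 1 else 0)" for \<beta>
    using coord_simple[OF \<alpha>(1)] by (simp add: coord_diff coord_add)
  ultimately show ?thesis
    using w by (auto simp: below_def Nats_iff_nonneg_Ints)
qed

text \<open>If \<open>\<alpha>\<close> did not occur in \<open>\<nu> - w\<close>, obtuseness would
  make this difference pair nonpositively with its coroot, so \<open>w\<close> would pair at least
  as high as the dominant \<open>\<nu>\<close>.\<close>

lemma below_raise:
  assumes \<nu>: "dominant_for \<Delta> C \<nu>" and w: "below w \<nu>" and \<alpha>: "\<alpha> \<in> B" "copair w \<alpha> < 0"
  shows "below (w + \<alpha>) \<nu>"
proof -
  have "coord \<alpha> (\<nu> - w) \<noteq> 0"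
  proof
    assume 0: "coord \<alpha> (\<nu> - w) = 0"
    have "copair (\<nu> - w) \<alpha> \<le> 0"
      unfolding copair_coord_expand[of "\<nu> - w"]
    proof (rule sum_nonpos)
      fix \<beta> assume "\<beta> \<in> B"
      then show "coord \<beta> (\<nu> - w) * copair \<beta> \<alpha> \<le> 0"
        using 0 belowD[OF w] copair_simple_nonpos[OF \<alpha>(1)] by (cases "\<beta> = \<alpha>") (auto simp: mult_le_0_iff)
    qed
    moreover have "copair \<nu> \<alpha> \<ge> 0" using \<nu> \<alpha> by (simp add: dominant_for_def)
    ultimately show False using \<alpha> by (simp add: copair_diff)
  qed
  then show ?thesis
    using below_add_if_coord_pos[OF w \<alpha>(1)] belowD[OF w \<alpha>(1)] by simp
qed

definition height :: "'a \<Rightarrow> nat" where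
  "height x = nat \<lfloor>\<Sum>\<beta>\<in>B. coord \<beta> x\<rfloor>"

lemma below_height_less:
  assumes "below (w + \<alpha>) \<nu>" "\<alpha> \<in> B"
  shows "height (\<nu> - (w + \<alpha>)) < height (\<nu> - w)"
proof -
  have "(\<Sum>\<beta>\<in>B. coord \<beta> \<alpha>) = 1"
    using assms finite_simple by (simp add: coord_simple)
  then have "(\<Sum>\<beta>\<in>B. coord \<beta> (\<nu> - w)) = (\<Sum>\<beta>\<in>B. coord \<beta> (\<nu> - (w + \<alpha>))) + 1"
    by (simp add: coord_diff coord_add sum_subtractf sum.distrib)
  \<comment> \<open>Nonnegativity prevents \<open>nat\<close> from truncating both heights to
    0.\<close>
  moreover have "(\<Sum>\<beta>\<in>B. coord \<beta> (\<nu> - (w + \<alpha>))) \<ge> 0"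
    using belowD[OF assms(1)] by (intro sum_nonneg) auto
  ultimately show ?thesis by (simp add: height_def nat_less_iff)
qed

lemma below_lower:
  assumes "below w \<nu>" "\<alpha> \<in> B"
  shows "below (w - \<alpha>) \<nu>"
proof -
  have "coord \<beta> (\<nu> - (w - \<alpha>)) = coord \<beta> (\<nu> - w) + (if \<beta> = \<alpha> then 1 else 0)" for \<beta>
    using coord_simple[OF assms(2)] by (simp add: coord_diff)
  then show ?thesis using assms(1) by (auto simp: below_def Nats_iff_nonneg_Ints)
qed

text \<open>Playing the numbers game from \<open>y + \<beta>\<close> only passes through elements \<open>y + \<beta>'\<close> with \<open>\<beta>'\<close> a positive
  root of the same length, all below \<open>\<nu>\<close>; it is never lost because \<open>\<beta>'\<close> pairs to at least \<open>-1\<close>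
  with the coroots of the roots that are at least as long.\<close>
lemma almost_dominant_add_short_root:
  assumes \<nu>: "dominant_for \<Delta> C \<nu>" and y: "dominant_for \<Delta> C y" "y \<in> weight_lattice \<Delta>"
    and short: "\<And>\<alpha>. \<alpha> \<in> B \<Longrightarrow> coord \<alpha> (\<nu> - y) > 0 \<Longrightarrow> l \<le> norm \<alpha>"
    and "\<beta> \<in> Pos" "norm \<beta> = l" "below (y + \<beta>) \<nu>"
  shows "almost_dominant (y + \<beta>)"
  using assms(5-)
proof (induction "height (\<nu> - (y + \<beta>))" arbitrary: \<beta> rule: less_induct)
  case less
  have wt: "y + \<beta> \<in> weight_lattice \<Delta>"
    using y less.prems Pos_root root_weight_lattice weight_lattice_add by blast
  show ?case
  proof (cases "dominant_for \<Delta> C (y + \<beta>)")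
    case True
    then show ?thesis using wt dominant_almost_dominant by blast
  next
    case False
    then obtain \<alpha> where \<alpha>: "\<alpha> \<in> B" "copair (y + \<beta>) \<alpha> < 0" by (auto simp: dominant_for_def not_le)
    note bel = below_raise[OF \<nu> less.prems(3) \<alpha>]
    have "coord \<alpha> (\<nu> - (y + \<beta> + \<alpha>)) \<ge> 0" using belowD[OF bel \<alpha>(1)] .
    moreover have "coord \<alpha> \<beta> \<ge> 0"
      using coord_Pos_Nats[OF less.prems(1) \<alpha>(1)] by (simp add: Nats_iff_nonneg_Ints)
    ultimately have "coord \<alpha> (\<nu> - y) > 0"
      using \<alpha> by (simp add: coord_diff coord_add coord_simple)
    then have len: "norm \<beta> \<le> norm \<alpha>" using short \<alpha> less.prems by simp
    have "\<beta> \<noteq> - \<alpha>" using minus_Pos[OF simple_pos[OF \<alpha>(1)]] less.prems by blast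
    then have "copair \<beta> \<alpha> \<ge> -1"
      using copair_ge_minus_1_if_shorter[OF simple_root[OF \<alpha>(1)] Pos_root[OF less.prems(1)] _ len] by blast
    moreover have "copair y \<alpha> \<ge> 0" using y \<alpha> by (simp add: dominant_for_def)
    moreover have "copair (y + \<beta>) \<alpha> \<le> -1"
      using Ints_neg_le_minus_1 \<alpha> weight_lattice_Ints wt simple_root by blast
    ultimately have eq: "copair \<beta> \<alpha> = -1" "copair (y + \<beta>) \<alpha> = -1" by (simp_all add: copair_add)
    have refl: "reflection \<alpha> \<beta> = \<beta> + \<alpha>" by (simp add: reflection_def eq)
    have "\<beta> \<noteq> \<alpha>" using eq copair_self[OF simple_nonzero[OF \<alpha>(1)]] by auto
    then have pos: "\<beta> + \<alpha> \<in> Pos" using reflection_simple_Pos[OF \<alpha>(1) less.prems(1)] refl by simp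
    have "norm (\<beta> + \<alpha>) = norm \<beta>"
      using inner_reflection[OF simple_nonzero[OF \<alpha>(1)], of \<beta> "\<beta> + \<alpha>"]
        reflection_reflection[OF simple_nonzero[OF \<alpha>(1)], of \<beta>]
      by (simp add: refl norm_eq)
    then have "almost_dominant (y + (\<beta> + \<alpha>))"
      using less.prems pos bel below_height_less[OF bel \<alpha>(1)] by (intro less.hyps) (simp_all add: add.assoc)
    moreover have "copair (y + (\<beta> + \<alpha>)) \<alpha> = 1"
      using eq copair_self[OF simple_nonzero[OF \<alpha>(1)]] by (simp add: copair_add)
    ultimately show ?thesis using almost_dominant_lower[of "y + (\<beta> + \<alpha>)" \<alpha>] \<alpha> by simp
  qed
qed

end

subsection \<open>Tuples of almost dominant weights\<close>

text \<open>The polytopes are out of sight here: each one is represented only by its vertex at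
  \<open>C\<close>.\<close>

locale tuples_below = chamber_base \<Delta> C for \<Delta> :: "'a::euclidean_space set" and C +
  fixes I :: "'i set" and \<mu> :: "'i \<Rightarrow> 'a"
  assumes finite_I: "finite I"
    and \<mu>_dominant: "i \<in> I \<Longrightarrow> dominant_for \<Delta> C (\<mu> i)"
begin

definition tuples :: "('i \<Rightarrow> 'a) set" where
  "tuples = (\<Pi>\<^sub>E i\<in>I. {w. almost_dominant w \<and> below w (\<mu> i)})"

text \<open>Membership of both ends is built in, so paths of steps starting at a tuple never leave
  the winning tuples.\<close>

definition step :: "('i \<Rightarrow> 'a) \<Rightarrow> ('i \<Rightarrow> 'a) \<Rightarrow> bool" where
  "step f g \<longleftrightarrow> f \<in> tuples \<and> g \<in> tuples \<and>
     (\<exists>\<beta>\<in>\<Delta>. \<exists>i\<in>I. \<exists>j\<in>I. i \<noteq> j \<and> g = f(i := f i + \<beta>, j := f j - \<beta>))"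

text \<open>The threshold 1 is what \<open>almost_dominant_lower\<close> asks for, so the lowered
  entry stays almost dominant.\<close>

definition lowerings :: "'a \<Rightarrow> ('i \<Rightarrow> 'a) \<Rightarrow> ('i \<Rightarrow> 'a) set" where
  "lowerings \<alpha> f = {f(j := f j - \<alpha>) |j. j \<in> I \<and> copair (f j) \<alpha> \<ge> 1}"

definition tuples_of_sum :: "'a \<Rightarrow> ('i \<Rightarrow> 'a) set" where
  "tuples_of_sum x = {f\<in>tuples. sum f I = x}"

lemma tuplesD: "f \<in> tuples \<Longrightarrow> i \<in> I \<Longrightarrow> almost_dominant (f i)"
  "f \<in> tuples \<Longrightarrow> i \<in> I \<Longrightarrow> below (f i) (\<mu> i)"
  by (auto simp: tuples_def)

lemma tuples_upd:
  "f \<in> tuples \<Longrightarrow> i \<in> I \<Longrightarrow> almost_dominant w \<Longrightarrow> below w (\<mu> i) \<Longrightarrow> f(i := w) \<in> tuples"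
  by (auto simp: tuples_def PiE_def extensional_def)

lemma sum_upd: "i \<in> I \<Longrightarrow> sum (f(i := f i + d)) I = sum f I + (d :: 'a)"
proof -
  have "f(i := f i + d) = (\<lambda>k. f k + (if k = i then d else 0))" by auto
  then show "sum (f(i := f i + d)) I = sum f I + d" if "i \<in> I"
    using finite_I that by (simp add: sum.distrib)
qed

lemma sum_upd_diff: "i \<in> I \<Longrightarrow> sum (f(i := f i - d)) I = sum f I - (d :: 'a)"
  using sum_upd[of i f "- d"] by simp

lemma step_sym: "step f g \<Longrightarrow> step g f"
proof -
  assume "step f g"
  then obtain \<beta> i j where *: "f \<in> tuples" "g \<in> tuples" "\<beta> \<in> \<Delta>" "i \<in> I" "j \<in> I" "i \<noteq> j"
    "g = f(i := f i + \<beta>, j := f j - \<beta>)" by (auto simp: step_def)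
  moreover from * have "f = g(j := g j + \<beta>, i := g i - \<beta>)" by auto
  ultimately show "step g f" unfolding step_def by metis
qed

lemma connected_sym: "step\<^sup>*\<^sup>* f g \<Longrightarrow> step\<^sup>*\<^sup>* g f"
  by (induction rule: rtranclp_induct) (auto intro: converse_rtranclp_into_rtranclp step_sym)

lemma step_sum: "step f g \<Longrightarrow> sum g I = sum f I"
proof -
  assume "step f g"
  then obtain \<beta> i j where *: "i \<in> I" "j \<in> I" "i \<noteq> j" "g = f(i := f i + \<beta>, j := f j - \<beta>)"
    by (auto simp: step_def)
  then show ?thesis
    using sum_upd_diff[of j "f(i := f i + \<beta>)" \<beta>] sum_upd[of i f \<beta>] by simp
qed

section \<open>Descent of root moves to lowered tuples\<close>

lemma lowerings_tuples:
  assumes "f \<in> tuples" "\<alpha> \<in> B" "f' \<in> lowerings \<alpha> f"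
  shows "f' \<in> tuples" "sum f' I = sum f I - \<alpha>"
proof -
  obtain j where j: "j \<in> I" "copair (f j) \<alpha> \<ge> 1" "f' = f(j := f j - \<alpha>)"
    using assms by (auto simp: lowerings_def)
  then show "f' \<in> tuples"
    using tuples_upd tuplesD assms almost_dominant_lower below_lower by simp
  show "sum f' I = sum f I - \<alpha>" using j sum_upd_diff by simp
qed

lemma copair_ge_1_if_pos:
  assumes "f \<in> tuples" "j \<in> I" "\<alpha> \<in> \<Delta>" "copair (f j) \<alpha> > 0"
  shows "copair (f j) \<alpha> \<ge> 1"
  using assms tuplesD almost_dominant_weight weight_lattice_Ints Ints_pos_ge_1 by blast

lemma lowerings_nonempty:
  assumes "f \<in> tuples" "\<alpha> \<in> B" "copair (sum f I) \<alpha> > 0"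
  shows "lowerings \<alpha> f \<noteq> {}"
proof -
  have "\<exists>j\<in>I. copair (f j) \<alpha> > 0"
    using assms(3) sum_nonpos[of I "\<lambda>j. copair (f j) \<alpha>"] by (force simp: copair_sum)
  then show ?thesis
    using copair_ge_1_if_pos assms simple_root by (auto simp: lowerings_def)
qed

lemma connected_if_differ_by_root:
  assumes "f \<in> tuples" "g \<in> tuples" "i \<in> I" "j \<in> I" "\<beta> \<in> \<Delta> \<or> \<beta> = 0"
    and "i \<noteq> j" "g = f(i := f i + \<beta>, j := f j - \<beta>)"
  shows "step\<^sup>*\<^sup>* f g"
proof (cases "\<beta> = 0")
  case True
  then show ?thesis using assms by simp
next
  case False
  then have "step f g" using assms unfolding step_def by blast
  then show ?thesis by blast
qed

text \<open>Lowerings of one tuple at \<open>i\<close> and at \<open>j\<close> differ by a move of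
  \<open>\<alpha>\<close> between these entries.\<close>

lemma lowerings_connected:
  assumes f: "f \<in> tuples" and \<alpha>: "\<alpha> \<in> B" and f': "f' \<in> lowerings \<alpha> f" and f'': "f'' \<in> lowerings \<alpha> f"
  shows "step\<^sup>*\<^sup>* f' f''"
proof -
  obtain i j where ij: "i \<in> I" "j \<in> I" "f' = f(i := f i - \<alpha>)" "f'' = f(j := f j - \<alpha>)"
    using f' f'' by (auto simp: lowerings_def)
  show ?thesis
  proof (cases "i = j")
    case False
    then show ?thesis
      using ij f f' f'' \<alpha> lowerings_tuples(1) simple_root
      by (intro connected_if_differ_by_root[of _ _ i j \<alpha>]) auto
  qed (simp add: ij)
qed

text \<open>If the two tuples cannot be lowered at a common index, then the pairing of \<open>\<alpha>\<close> with the root \<open>\<beta>\<close>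
  of the move forces \<open>\<alpha> + \<beta>\<close> to be a root (or zero), and the lowered tuples differ by \<open>\<alpha> + \<beta>\<close>.\<close>
lemma lowerings_of_move_connected:
  assumes f: "f \<in> tuples" and g: "g \<in> tuples" and \<alpha>: "\<alpha> \<in> B" and \<beta>: "\<beta> \<in> \<Delta>"
    and ij: "i \<in> I" "j \<in> I" "i \<noteq> j" and g_eq: "g = f(i := f i + \<beta>, j := f j - \<beta>)"
    and fi: "copair (f i) \<alpha> \<ge> 1" and gj: "copair (g j) \<alpha> \<ge> 1"
  shows "step\<^sup>*\<^sup>* (f(i := f i - \<alpha>)) (g(j := g j - \<alpha>))"
proof -
  have lf: "f(i := f i - \<alpha>) \<in> lowerings \<alpha> f" and lg: "g(j := g j - \<alpha>) \<in> lowerings \<alpha> g"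
    using ij fi gj unfolding lowerings_def by blast+
  show ?thesis
  proof (cases "copair (g i) \<alpha> \<ge> 1")
    case True
    then have lg': "g(i := g i - \<alpha>) \<in> lowerings \<alpha> g" using ij unfolding lowerings_def by blast
    then have "step\<^sup>*\<^sup>* (f(i := f i - \<alpha>)) (g(i := g i - \<alpha>))"
      using ij(3) by (intro connected_if_differ_by_root[OF lowerings_tuples(1)[OF f \<alpha> lf]
            lowerings_tuples(1)[OF g \<alpha> lg'] ij(1,2) disjI1[OF \<beta>] ij(3)]) (auto simp: g_eq fun_eq_iff)
    then show ?thesis using lowerings_connected[OF g \<alpha> lg' lg] by (meson rtranclp_trans)
  next
    case False
    then have "copair (g i) \<alpha> \<le> 0"
      using copair_ge_1_if_pos[OF g ij(1) simple_root[OF \<alpha>]] by linarith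
    then have "copair \<beta> \<alpha> < 0" using fi ij g_eq by (simp add: copair_add)
    then have "\<alpha> + \<beta> \<in> \<Delta> \<or> \<alpha> + \<beta> = 0"
      using add_root_if_copair_neg[OF simple_root[OF \<alpha>] \<beta>] by (auto simp: eq_neg_iff_add_eq_0 add.commute)
    then show ?thesis
      using ij(3) by (intro connected_if_differ_by_root[OF lowerings_tuples(1)[OF f \<alpha> lf]
            lowerings_tuples(1)[OF g \<alpha> lg] ij(1,2) _ ij(3), of "\<alpha> + \<beta>"]) (auto simp: g_eq fun_eq_iff)
  qed
qed

lemma lowerings_of_step_connected:
  assumes fg: "step f g" and \<alpha>: "\<alpha> \<in> B"
    and f': "f' \<in> lowerings \<alpha> f" and g': "g' \<in> lowerings \<alpha> g"
  shows "step\<^sup>*\<^sup>* f' g'"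
proof -
  have f: "f \<in> tuples" and g: "g \<in> tuples" using fg by (auto simp: step_def)
  obtain \<beta> i j where \<beta>: "\<beta> \<in> \<Delta>" and ij: "i \<in> I" "j \<in> I" "i \<noteq> j"
    and g_eq: "g = f(i := f i + \<beta>, j := f j - \<beta>)" using fg by (auto simp: step_def)
  obtain a where a: "a \<in> I" "copair (f a) \<alpha> \<ge> 1" "f' = f(a := f a - \<alpha>)"
    using f' by (auto simp: lowerings_def)
  obtain b where b: "b \<in> I" "copair (g b) \<alpha> \<ge> 1" "g' = g(b := g b - \<alpha>)"
    using g' by (auto simp: lowerings_def)
  \<comment> \<open>Lowering both tuples at the same entry leaves their difference unchanged, so the
    same root move connects them.\<close>
  have common: ?thesis if c: "c \<in> I" "copair (f c) \<alpha> \<ge> 1" "copair (g c) \<alpha> \<ge> 1" for c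
  proof -
    have lf: "f(c := f c - \<alpha>) \<in> lowerings \<alpha> f" and lg: "g(c := g c - \<alpha>) \<in> lowerings \<alpha> g"
      using c unfolding lowerings_def by blast+
    have "step\<^sup>*\<^sup>* (f(c := f c - \<alpha>)) (g(c := g c - \<alpha>))"
      using ij(3) by (intro connected_if_differ_by_root[OF lowerings_tuples(1)[OF f \<alpha> lf]
            lowerings_tuples(1)[OF g \<alpha> lg] ij(1,2) disjI1[OF \<beta>] ij(3)]) (auto simp: g_eq fun_eq_iff)
    then show ?thesis
      using lowerings_connected[OF f \<alpha> f' lf] lowerings_connected[OF g \<alpha> lg g'] by (meson rtranclp_trans)
  qed
  \<comment> \<open>Without a common entry, both \<open>a\<close> and \<open>b\<close> are entries
    changed by the move, and they are different.\<close>
  consider "copair (g a) \<alpha> \<ge> 1" | "copair (f b) \<alpha> \<ge> 1" | "a = i" "b = j" | "a = j" "b = i"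
    using a b g_eq by (cases "a = i"; cases "a = j"; cases "b = i"; cases "b = j") auto
  then show ?thesis
  proof cases
    case 1 then show ?thesis using common a by blast
  next
    case 2 then show ?thesis using common b by blast
  next
    case 3
    then show ?thesis using lowerings_of_move_connected[OF f g \<alpha> \<beta> ij g_eq] a b by simp
  next
    case 4
    \<comment> \<open>The roles of \<open>i\<close> and \<open>j\<close> are exchanged by reading
      the move as one by \<open>- \<beta>\<close>.\<close>
    have "g = f(j := f j + - \<beta>, i := f i - - \<beta>)" using ij g_eq by auto
    then show ?thesis
      using lowerings_of_move_connected[OF f g \<alpha> minus_root[OF \<beta>], of j i] ij 4 a b by simp
  qed
qed

text \<open>Every intermediate tuple has the same sum, hence by \<open>pos\<close> has a lowering,
  through which the lowered path can pass.\<close>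

lemma lowerings_of_connected_connected:
  assumes "step\<^sup>*\<^sup>* f g" and f: "f \<in> tuples" and \<alpha>: "\<alpha> \<in> B" and pos: "copair (sum f I) \<alpha> > 0"
    and f': "f' \<in> lowerings \<alpha> f" and g': "g' \<in> lowerings \<alpha> g"
  shows "step\<^sup>*\<^sup>* f' g'"
  using assms(1) g'
proof (induction arbitrary: g' rule: rtranclp_induct)
  case base
  then show ?case using lowerings_connected f \<alpha> f' by blast
next
  case (step h k)
  have "sum h I = sum f I" using step.hyps(1) by (induction rule: rtranclp_induct) (simp_all add: step_sum)
  moreover have "h \<in> tuples" using step.hyps(2) by (simp add: step_def)
  ultimately obtain h' where h': "h' \<in> lowerings \<alpha> h" using lowerings_nonempty[OF _ \<alpha>, of h] pos by auto
  then have "step\<^sup>*\<^sup>* f' h'" using step.IH by blast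
  moreover have "step\<^sup>*\<^sup>* h' g'"
    using lowerings_of_step_connected[OF step.hyps(2) \<alpha> h' step.prems] .
  ultimately show ?case by (rule rtranclp_trans)
qed

section \<open>Fibres of the sum map\<close>

definition connected_fiber :: "'a \<Rightarrow> bool" where
  "connected_fiber x \<longleftrightarrow> tuples_of_sum x \<noteq> {} \<and> (\<forall>f\<in>tuples_of_sum x. \<forall>g\<in>tuples_of_sum x. step\<^sup>*\<^sup>* f g)"

text \<open>Nonemptiness comes from lowering any tuple upstairs. For connectedness, two tuples are
  moved to lowerings, whose sources are joined upstairs, and that path descends.\<close>

lemma connected_fiber_lower:
  assumes fib: "connected_fiber (x + \<alpha>)" and \<alpha>: "\<alpha> \<in> B" and pos: "copair (x + \<alpha>) \<alpha> > 0"
    and lift: "\<And>f. f \<in> tuples_of_sum x \<Longrightarrow> \<exists>f'. step\<^sup>*\<^sup>* f f' \<and> (\<exists>g\<in>tuples_of_sum (x + \<alpha>). f' \<in> lowerings \<alpha> g)"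
  shows "connected_fiber x"
  unfolding connected_fiber_def
proof (intro conjI ballI)
  obtain g where g: "g \<in> tuples" "sum g I = x + \<alpha>"
    using fib by (auto simp: connected_fiber_def tuples_of_sum_def)
  then obtain f where "f \<in> lowerings \<alpha> g" using lowerings_nonempty[OF g(1) \<alpha>] pos by auto
  then have "f \<in> tuples_of_sum x"
    using lowerings_tuples[OF g(1) \<alpha>] g by (simp add: tuples_of_sum_def)
  then show "tuples_of_sum x \<noteq> {}" by blast
  fix f1 f2 assume "f1 \<in> tuples_of_sum x" "f2 \<in> tuples_of_sum x"
  then obtain f1' f2' g1 g2 where *: "step\<^sup>*\<^sup>* f1 f1'" "step\<^sup>*\<^sup>* f2 f2'"
    "g1 \<in> tuples_of_sum (x + \<alpha>)" "g2 \<in> tuples_of_sum (x + \<alpha>)"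
    "f1' \<in> lowerings \<alpha> g1" "f2' \<in> lowerings \<alpha> g2"
    using lift by meson
  then have "step\<^sup>*\<^sup>* g1 g2" using fib by (simp add: connected_fiber_def)
  then have "step\<^sup>*\<^sup>* f1' f2'"
    using lowerings_of_connected_connected[OF _ _ \<alpha>] * pos by (simp add: tuples_of_sum_def)
  then show "step\<^sup>*\<^sup>* f1 f2"
    using * connected_sym by (meson rtranclp_trans)
qed

text \<open>Raising adds 2 to the pairing, so a pairing of at least -1 becomes at least 1 and the
  raise can be undone as a lowering.\<close>

lemma lift_tuple:
  assumes f: "f \<in> tuples_of_sum x" and j: "j \<in> I" and \<alpha>: "\<alpha> \<in> B"
    and "almost_dominant (f j + \<alpha>)" "below (f j + \<alpha>) (\<mu> j)" "copair (f j) \<alpha> \<ge> -1"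
  shows "\<exists>g\<in>tuples_of_sum (x + \<alpha>). f \<in> lowerings \<alpha> g"
proof (rule bexI)
  let ?g = "f(j := f j + \<alpha>)"
  show "?g \<in> tuples_of_sum (x + \<alpha>)"
    using assms tuples_upd sum_upd[of j f \<alpha>] by (simp add: tuples_of_sum_def)
  have "copair (?g j) \<alpha> \<ge> 1"
    using assms copair_self[OF simple_nonzero[OF \<alpha>]] by (simp add: copair_add)
  moreover have "f = ?g(j := ?g j - \<alpha>)" by simp
  ultimately show "f \<in> lowerings \<alpha> ?g" using j unfolding lowerings_def by blast
qed

text \<open>Root moves with simple roots other than \<open>s\<close> make the entry at \<open>j\<close> dominant without changing
  its \<open>s\<close>-coordinate, unless that entry can be raised by \<open>s\<close> on the way.\<close>
lemma lift_along_short_simple_root: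
  assumes f: "f \<in> tuples_of_sum x" and x: "dominant_for \<Delta> C x" and s: "s \<in> B" and j: "j \<in> I"
    and short: "\<And>\<alpha>. \<alpha> \<in> B \<Longrightarrow> coord \<alpha> (sum \<mu> I - x) > 0 \<Longrightarrow> norm s \<le> norm \<alpha>"
    and pos: "coord s (\<mu> j - f j) > 0"
  shows "\<exists>f'. step\<^sup>*\<^sup>* f f' \<and> (\<exists>g\<in>tuples_of_sum (x + s). f' \<in> lowerings s g)"
  using f pos
proof (induction "height (\<mu> j - f j)" arbitrary: f rule: less_induct)
  case less
  have ft: "f \<in> tuples" and fx: "sum f I = x" using less.prems by (auto simp: tuples_of_sum_def)
  note ad = tuplesD(1)[OF ft j] and bel = tuplesD(2)[OF ft j]
  have raise: ?case if "almost_dominant (f j + s)" "below (f j + s) (\<mu> j)"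
    using lift_tuple[OF less.prems(1) j s that] almost_dominantD[OF ad simple_pos[OF s]] by blast
  consider "copair (f j) s < 0" | "copair (f j) s \<ge> 0" "\<not> dominant_for \<Delta> C (f j)" | "dominant_for \<Delta> C (f j)"
    by fastforce
  then show ?case
  proof cases
    case 1
    then show ?thesis
      using raise almost_dominant_raise(3)[OF ad s] below_raise[OF \<mu>_dominant[OF j] bel s] by blast
  next
    case 2
    then obtain \<alpha> where \<alpha>: "\<alpha> \<in> B" "copair (f j) \<alpha> < 0" by (auto simp: dominant_for_def not_le)
    \<comment> \<open>Since \<open>x\<close> is dominant, the negative pairing at \<open>j\<close>
      is compensated by another entry, which can give up \<open>\<alpha>\<close>.\<close>
    have "\<exists>l\<in>I. copair (f l) \<alpha> > 0"
    proof (rule ccontr)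
      assume "\<not> ?thesis"
      then have "(\<Sum>i\<in>I. copair (f i) \<alpha>) < (\<Sum>i\<in>I. 0)"
        using \<alpha> j finite_I by (intro sum_strict_mono_ex1) auto
      then show False using x \<alpha>(1) fx[symmetric] by (auto simp: dominant_for_def copair_sum)
    qed
    then obtain l where l: "l \<in> I" "copair (f l) \<alpha> \<ge> 1"
      using copair_ge_1_if_pos[OF ft _ simple_root[OF \<alpha>(1)]] by blast
    have "l \<noteq> j" using l \<alpha> by auto
    let ?h = "f(j := f j + \<alpha>, l := f l - \<alpha>)"
    note bel' = below_raise[OF \<mu>_dominant[OF j] bel \<alpha>]
    have "almost_dominant (f l - \<alpha>)" "below (f l - \<alpha>) (\<mu> l)"
      using almost_dominant_lower below_lower tuplesD[OF ft l(1)] \<alpha>(1) l(2) by blast+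
    then have "?h \<in> tuples"
      using ft j l bel' almost_dominant_raise(3)[OF ad \<alpha>] by (intro tuples_upd)
    then have st: "step f ?h" using ft j l(1) simple_root[OF \<alpha>(1)] \<open>l \<noteq> j\<close> unfolding step_def
      by (intro conjI bexI[of _ \<alpha>] bexI[of _ j] bexI[of _ l]) auto
    have "?h \<in> tuples_of_sum x" using \<open>?h \<in> tuples\<close> step_sum[OF st] fx unfolding tuples_of_sum_def by blast
    moreover have "coord s (\<mu> j - ?h j) > 0"
      using less.prems(2) \<open>l \<noteq> j\<close> \<alpha> 2(1) by (auto simp: coord_diff coord_add coord_simple[OF \<alpha>(1)])
    moreover have "height (\<mu> j - ?h j) < height (\<mu> j - f j)"
      using below_height_less[OF bel' \<alpha>(1)] \<open>l \<noteq> j\<close> by simp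
    ultimately obtain f' where f': "step\<^sup>*\<^sup>* ?h f'" "\<exists>g\<in>tuples_of_sum (x + s). f' \<in> lowerings s g"
      using less.hyps by blast
    then show ?thesis using st by (meson converse_rtranclp_into_rtranclp)
  next
    case 3
    note bels = below_add_if_coord_pos[OF bel s less.prems(2)]
    \<comment> \<open>The entry differences have nonnegative coordinates, so a simple root occurring
      at \<open>j\<close> also occurs in the total, where \<open>short\<close> applies.\<close>
    have "norm s \<le> norm \<alpha>" if "\<alpha> \<in> B" "coord \<alpha> (\<mu> j - f j) > 0" for \<alpha>
    proof -
      have "coord \<alpha> (sum \<mu> I - x) = (\<Sum>i\<in>I. coord \<alpha> (\<mu> i - f i))"
        by (simp add: fx[symmetric] coord_diff coord_sum sum_subtractf)
      also have "\<dots> > 0"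
        using that j finite_I belowD tuplesD(2)[OF ft] by (intro sum_pos2[of _ j]) auto
      finally show ?thesis using short that by blast
    qed
    then have "almost_dominant (f j + s)"
      using almost_dominant_add_short_root[OF \<mu>_dominant[OF j] 3 almost_dominant_weight[OF ad]] bels s simple_pos
      by blast
    then show ?thesis using raise bels by blast
  qed
qed

text \<open>The differences \<open>\<mu> i - f i\<close> have nonnegative coordinates with sum 0, so
  the tuple of the \<open>\<mu> i\<close> is the only one.\<close>

lemma connected_fiber_top:
  assumes \<mu>: "\<And>i. i \<in> I \<Longrightarrow> \<mu> i \<in> weight_lattice \<Delta>"
  shows "connected_fiber (sum \<mu> I)"
proof -
  have "restrict \<mu> I \<in> tuples_of_sum (sum \<mu> I)"
    using \<mu> \<mu>_dominant dominant_almost_dominant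
    by (auto simp: tuples_of_sum_def tuples_def below_def coord_zero)
  moreover have "f = restrict \<mu> I" if "f \<in> tuples_of_sum (sum \<mu> I)" for f
  proof -
    have f: "f \<in> tuples" and fx: "sum f I = sum \<mu> I" using that by (auto simp: tuples_of_sum_def)
    have "f i = \<mu> i" if i: "i \<in> I" for i
    proof (rule coord_eqI)
      fix \<beta> assume \<beta>: "\<beta> \<in> B"
      have "(\<Sum>i\<in>I. coord \<beta> (\<mu> i - f i)) = 0"
        using fx by (simp add: coord_diff sum_subtractf flip: coord_sum)
      then have "coord \<beta> (\<mu> i - f i) = 0"
        using sum_nonneg_0[OF finite_I, of "\<lambda>i. coord \<beta> (\<mu> i - f i)"] i belowD[OF tuplesD(2)[OF f] \<beta>] by blast
      then show "coord \<beta> (f i) = coord \<beta> (\<mu> i)" by (simp add: coord_diff)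
    qed
    then show ?thesis using f by (auto simp: tuples_def PiE_def extensional_def fun_eq_iff)
  qed
  ultimately show ?thesis unfolding connected_fiber_def by blast
qed

theorem connected_fiber:
  assumes \<mu>: "\<And>i. i \<in> I \<Longrightarrow> \<mu> i \<in> weight_lattice \<Delta>"
    and "almost_dominant x" "below x (sum \<mu> I)"
  shows "connected_fiber x"
  using assms(2-)
proof (induction "height (sum \<mu> I - x)" arbitrary: x rule: less_induct)
  case less
  have \<mu>_sum: "dominant_for \<Delta> C (sum \<mu> I)"
    using \<mu>_dominant by (auto simp: dominant_for_def copair_sum intro!: sum_nonneg)
  consider "x = sum \<mu> I" | "\<not> dominant_for \<Delta> C x" | "x \<noteq> sum \<mu> I" "dominant_for \<Delta> C x" by blast
  then show ?case
  proof cases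
    case 1
    then show ?thesis using connected_fiber_top[OF \<mu>] by simp
  next
    case 2
    then obtain \<alpha> where \<alpha>: "\<alpha> \<in> B" "copair x \<alpha> < 0" by (auto simp: dominant_for_def not_le)
    note raise = almost_dominant_raise[OF less.prems(1) \<alpha>]
    note bel = below_raise[OF \<mu>_sum less.prems(2) \<alpha>]
    show ?thesis
    proof (rule connected_fiber_lower)
      show "connected_fiber (x + \<alpha>)" using less.hyps below_height_less[OF bel \<alpha>(1)] raise bel by blast
      show "copair (x + \<alpha>) \<alpha> > 0"
        using raise(1) copair_self[OF simple_nonzero[OF \<alpha>(1)]] by (simp add: copair_add)
      fix f assume f: "f \<in> tuples_of_sum x"
      then have ft: "f \<in> tuples" by (simp add: tuples_of_sum_def)
      \<comment> \<open>A negative total forces a negative entry. Raising that entry shows that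
        \<open>f\<close> is itself a lowering, so no root move is needed here.\<close>
      have "\<exists>j\<in>I. copair (f j) \<alpha> < 0"
        using f \<alpha>(2) sum_nonneg[of I "\<lambda>j. copair (f j) \<alpha>"] by (force simp: tuples_of_sum_def copair_sum)
      then obtain j where j: "j \<in> I" "copair (f j) \<alpha> < 0" by blast
      then have "\<exists>g\<in>tuples_of_sum (x + \<alpha>). f \<in> lowerings \<alpha> g"
        using almost_dominant_raise[OF tuplesD(1)[OF ft j(1)] \<alpha>(1)]
          below_raise[OF \<mu>_dominant[OF j(1)] tuplesD(2)[OF ft j(1)] \<alpha>(1)]
        by (intro lift_tuple[OF f j(1) \<alpha>(1)]) auto
      then show "\<exists>f'. step\<^sup>*\<^sup>* f f' \<and> (\<exists>g\<in>tuples_of_sum (x + \<alpha>). f' \<in> lowerings \<alpha> g)" by blast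
    qed (fact \<alpha>(1))
  next
    case 3
    let ?S = "{\<alpha>\<in>B. coord \<alpha> (sum \<mu> I - x) > 0}"
    have "?S \<noteq> {}"
      using 3(1) coord_eqI[of x "sum \<mu> I"] belowD[OF less.prems(2)] by (force simp: coord_diff)
    then obtain s where s: "s \<in> B" "coord s (sum \<mu> I - x) > 0"
      and short: "\<And>\<alpha>. \<alpha> \<in> B \<Longrightarrow> coord \<alpha> (sum \<mu> I - x) > 0 \<Longrightarrow> norm s \<le> norm \<alpha>"
      using finite_simple arg_min_if_finite[of ?S norm]
      by (intro that[of "arg_min_on norm ?S"]) (auto simp: not_less)
    note bel = below_add_if_coord_pos[OF less.prems(2) s]
    show ?thesis
    proof (rule connected_fiber_lower)
      have "almost_dominant (x + s)"
        using almost_dominant_add_short_root[OF \<mu>_sum 3(2) almost_dominant_weight[OF less.prems(1)] short]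
          simple_pos s bel by blast
      then show "connected_fiber (x + s)" using less.hyps below_height_less[OF bel s(1)] bel by blast
      show "copair (x + s) s > 0"
        using 3(2) s(1) copair_self[OF simple_nonzero[OF s(1)]] by (simp add: copair_add dominant_for_def add_nonneg_pos)
      fix f assume f: "f \<in> tuples_of_sum x"
      have "(\<Sum>j\<in>I. coord s (\<mu> j - f j)) > 0"
        using s(2) f by (auto simp: tuples_of_sum_def coord_diff coord_sum sum_subtractf)
      then have "\<exists>j\<in>I. coord s (\<mu> j - f j) > 0"
        using sum_nonpos[of I "\<lambda>j. coord s (\<mu> j - f j)"] by force
      then show "\<exists>f'. step\<^sup>*\<^sup>* f f' \<and> (\<exists>g\<in>tuples_of_sum (x + s). f' \<in> lowerings s g)"
        using lift_along_short_simple_root[OF f 3(2) s(1) _ short] by blast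
    qed (fact s(1))
  qed
qed

end

subsection \<open>Adjacent chambers and ample polytopes\<close>

context chamber_base
begin

section \<open>Reflected chambers and their walls\<close>

lemma chamber_base_reflection: "\<alpha> \<in> \<Delta> \<Longrightarrow> chamber_base \<Delta> (reflection \<alpha> ` C)"
  using reflection_chamber chamber by unfold_locales

lemma Pos_reflection:
  assumes "\<alpha> \<in> \<Delta>"
  shows "\<gamma> \<in> positive_roots \<Delta> (reflection \<alpha> ` C) \<longleftrightarrow> reflection \<alpha> \<gamma> \<in> Pos"
  using assms reflection_root reflection_reflection[OF root_nonzero[OF assms]]
  by (auto simp: positive_roots_def inner_reflection[OF root_nonzero[OF assms]]) metis

lemma simple_reflection:
  assumes "\<alpha> \<in> \<Delta>"
  shows "\<gamma> \<in> simple_roots \<Delta> (reflection \<alpha> ` C) \<longleftrightarrow> reflection \<alpha> \<gamma> \<in> B"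
proof -
  let ?s = "reflection \<alpha>"
  note invol = reflection_reflection[OF root_nonzero[OF assms]]
  have add: "?s (x + y) = ?s x + ?s y" for x y
    by (simp add: linear_add linear_reflection)
  have "(\<exists>\<beta> \<delta>. ?s \<beta> \<in> Pos \<and> ?s \<delta> \<in> Pos \<and> \<gamma> = \<beta> + \<delta>) \<longleftrightarrow> (\<exists>\<beta> \<delta>. \<beta> \<in> Pos \<and> \<delta> \<in> Pos \<and> ?s \<gamma> = \<beta> + \<delta>)"
    by (metis add invol)
  then show ?thesis
    using Pos_reflection[OF assms] unfolding simple_roots_def by blast
qed

text \<open>Reflecting basis and vector together preserves coefficients; this is what compares the
  coordinates on the two sides of a wall.\<close>

lemma coord_reflection:
  assumes "\<alpha> \<in> \<Delta>" "\<gamma> \<in> B"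
  shows "chamber_base.coord \<Delta> (reflection \<alpha> ` C) (reflection \<alpha> \<gamma>) (reflection \<alpha> x) = coord \<gamma> x"
proof -
  interpret t: chamber_base \<Delta> "reflection \<alpha> ` C" using chamber_base_reflection assms by blast
  note invol = reflection_reflection[OF root_nonzero[OF assms(1)]]
  have simple: "reflection \<alpha> \<beta> \<in> t.B" if "\<beta> \<in> B" for \<beta>
    using simple_reflection[OF assms(1)] that by (simp add: invol)
  have "reflection \<alpha> x = (\<Sum>\<beta>\<in>B. coord \<beta> x *\<^sub>R reflection \<alpha> \<beta>)"
    by (subst coord_expand[of x])
      (simp add: linear_sum linear_scale linear_reflection)
  then have "t.coord (reflection \<alpha> \<gamma>) (reflection \<alpha> x) = (\<Sum>\<beta>\<in>B. if \<beta> = \<gamma> then coord \<beta> x else 0)"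
    using simple inj_reflection[OF root_nonzero[OF assms(1)]]
    by (auto simp: t.coord_sum t.coord_scaleR t.coord_simple inj_eq intro!: sum.cong)
  then show ?thesis using assms finite_simple by simp
qed

lemma minus_simple_reflection: "\<alpha> \<in> B \<Longrightarrow> - \<alpha> \<in> simple_roots \<Delta> (reflection \<alpha> ` C)"
  using simple_reflection[OF simple_root, of \<alpha> "- \<alpha>"] reflection_self[OF simple_nonzero]
  by (simp add: linear_neg linear_reflection)

text \<open>Among the positive roots, the simple reflection makes only \<open>\<alpha>\<close>
  negative, which gives uniqueness.\<close>

lemma separating_root_reflection:
  assumes "\<alpha> \<in> B"
  shows "separating_root \<Delta> C (reflection \<alpha> ` C) = \<alpha>"
  unfolding separating_root_def
proof (rule the_equality)
  note \<alpha> = simple_root[OF assms]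
  show "\<alpha> \<in> \<Delta> \<and> (\<forall>v\<in>C. \<alpha> \<bullet> v > 0) \<and> (\<forall>v\<in>reflection \<alpha> ` C. \<alpha> \<bullet> v < 0)"
    using \<alpha> Pos_inner[OF simple_pos[OF assms]]
    by (simp flip: inner_reflection[OF root_nonzero[OF \<alpha>]] add: reflection_self[OF root_nonzero[OF \<alpha>]])
  fix \<beta> assume \<beta>: "\<beta> \<in> \<Delta> \<and> (\<forall>v\<in>C. \<beta> \<bullet> v > 0) \<and> (\<forall>v\<in>reflection \<alpha> ` C. \<beta> \<bullet> v < 0)"
  then have "\<beta> \<in> Pos" by (simp add: positive_roots_def)
  moreover have "reflection \<alpha> \<beta> \<notin> Pos"
  proof
    assume "reflection \<alpha> \<beta> \<in> Pos"
    then have "\<beta> \<in> positive_roots \<Delta> (reflection \<alpha> ` C)" using Pos_reflection[OF \<alpha>] by simp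
    then show False using \<beta> chamber_nonempty by (fastforce simp: positive_roots_def)
  qed
  ultimately show "\<beta> = \<alpha>" using reflection_simple_Pos[OF assms] by blast
qed

text \<open>It suffices to find a point of the hyperplane where all other simple roots are positive:
  near it the hyperplane lies in the closed chamber, so the face has the dimension of the
  hyperplane.\<close>

lemma wall_facet:
  assumes "\<alpha> \<in> B"
  shows "(closure C \<inter> {v. \<alpha> \<bullet> v = 0}) facet_of closure C"
proof -
  let ?H = "{v. \<alpha> \<bullet> v = 0}" and ?F = "closure C \<inter> {v. \<alpha> \<bullet> v = 0}"
  let ?U = "\<Inter>\<beta>\<in>B - {\<alpha>}. {v. \<beta> \<bullet> v > 0}"
  have nz: "\<alpha> \<noteq> 0" using simple_nonzero assms .
  obtain v0 where v0: "v0 \<in> C" using chamber_nonempty by blast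
  \<comment> \<open>The orthogonal projection of \<open>v0\<close> onto the wall. By obtuseness it
    does not decrease the values of the other simple roots.\<close>
  define p where "p = v0 - ((\<alpha> \<bullet> v0) / (\<alpha> \<bullet> \<alpha>)) *\<^sub>R \<alpha>"
  have "p \<in> ?H" using nz by (simp add: p_def inner_diff_right)
  moreover have "\<beta> \<bullet> p > 0" if \<beta>: "\<beta> \<in> B" "\<beta> \<noteq> \<alpha>" for \<beta>
  proof -
    have "(\<alpha> \<bullet> v0) / (\<alpha> \<bullet> \<alpha>) * (\<beta> \<bullet> \<alpha>) \<le> 0"
      using simple_obtuse[OF \<beta>(1) assms \<beta>(2)] Pos_inner[OF simple_pos[OF assms] v0]
      by (intro mult_nonneg_nonpos divide_nonneg_nonneg) auto
    then show ?thesis using Pos_inner[OF simple_pos[OF \<beta>(1)] v0] by (simp add: p_def inner_diff_right)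
  qed
  ultimately have "p \<in> ?H \<inter> ?U" by auto
  have "open ?U" using finite_simple by (intro open_INT) (auto simp: open_halfspace_gt)
  have sub: "?H \<inter> ?U \<subseteq> ?F"
  proof
    fix v assume v: "v \<in> ?H \<inter> ?U"
    then have simple_nonneg: "\<beta> \<bullet> v \<ge> 0" if "\<beta> \<in> B" for \<beta>
      using that by (cases "\<beta> = \<alpha>") (auto intro: less_imp_le)
    have "\<gamma> \<bullet> v \<ge> 0" if "\<gamma> \<in> Pos" for \<gamma>
    proof -
      have "v \<bullet> \<gamma> \<ge> 0"
        unfolding inner_coord_expand[of v \<gamma>] using coord_Pos_Nats[OF that] simple_nonneg
        by (auto simp: Nats_iff_nonneg_Ints inner_commute intro!: sum_nonneg)
      then show ?thesis by (simp add: inner_commute)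
    qed
    then have "v \<in> closure C" unfolding closure_chamber by blast
    then show "v \<in> ?F" using v by blast
  qed
  have "aff_dim (?H \<inter> ?U) = aff_dim ?H"
    using \<open>p \<in> ?H \<inter> ?U\<close> \<open>open ?U\<close> by (intro aff_dim_convex_Int_open convex_hyperplane) auto
  then have "aff_dim ?F = aff_dim ?H"
    using aff_dim_subset[OF sub] aff_dim_subset[of ?F ?H] by auto
  moreover have "aff_dim (closure C) = DIM('a)"
    using aff_dim_open[OF open_chamber chamber_nonempty] aff_dim_subset[OF closure_subset[of C]]
      aff_dim_le_DIM[of "closure C"] by linarith
  moreover have "?F face_of closure C"
  proof (rule face_of_Int_supporting_hyperplane_ge)
    show "convex (closure C)" by (rule convex_closure[OF convex_chamber])
    show "\<alpha> \<bullet> v \<ge> 0" if "v \<in> closure C" for v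
      using that simple_pos[OF assms] by (simp add: closure_chamber)
  qed
  ultimately show ?thesis
    using nz sub \<open>p \<in> ?H \<inter> ?U\<close> unfolding facet_of_def by auto
qed

text \<open>The reflection fixes its hyperplane pointwise, so both closed chambers have the same
  intersection with it.\<close>

lemma adjacent_reflection:
  assumes "\<alpha> \<in> B"
  shows "adjacent_chambers \<Delta> C (reflection \<alpha> ` C)"
proof -
  note \<alpha> = simple_root[OF assms] and nz = simple_nonzero[OF assms]
  interpret t: chamber_base \<Delta> "reflection \<alpha> ` C" using chamber_base_reflection \<alpha> by blast
  have invol: "reflection \<alpha> (reflection \<alpha> v) = v" for v using reflection_reflection[OF nz] .
  have "v \<in> closure (reflection \<alpha> ` C) \<longleftrightarrow> v \<in> closure C" if "\<alpha> \<bullet> v = 0" for v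
  proof -
    have "reflection \<alpha> v = v" using that by (simp add: reflection_def copair_def inner_commute)
    then have "reflection \<alpha> \<gamma> \<bullet> v = \<gamma> \<bullet> v" for \<gamma> by (simp add: inner_reflection[OF nz])
    then show ?thesis
      unfolding closure_chamber t.closure_chamber using Pos_reflection[OF \<alpha>] invol by simp metis
  qed
  \<comment> \<open>The sign on the right matches \<open>wall_facet\<close> for the other chamber,
    where \<open>- \<alpha>\<close> is the simple root.\<close>
  then have "closure C \<inter> {v. \<alpha> \<bullet> v = 0} = closure (reflection \<alpha> ` C) \<inter> {v. - \<alpha> \<bullet> v = 0}" by auto
  moreover have "C \<noteq> reflection \<alpha> ` C"
    using minus_simple_reflection[OF assms] simple_pos[OF assms] simple_pos minus_Pos by metis
  ultimately show ?thesis
    using wall_facet[OF assms] t.wall_facet[OF minus_simple_reflection[OF assms]] chamber t.chamber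
    unfolding adjacent_chambers_def by metis
qed

section \<open>Walks through the chambers\<close>

lemma reflection_minus: "reflection (- \<alpha>) = reflection \<alpha>"
  by (rule ext) (simp add: reflection_def copair_minus_right)

text \<open>The induction counts the roots positive on \<open>\<sigma>\<close> but not on
  \<open>C\<close>. The condition \<open>\<beta> \<in> Pos\<close> says that each step leads away
  from \<open>C\<close>; it gives the direction in which vertices move and the bound on the pairing
  with \<open>\<beta>\<close>.\<close>

lemma chamber_induct [consumes 1, case_names base step]:
  assumes "\<sigma> \<in> chambers \<Delta>" and base: "P C"
    and step: "\<And>\<sigma> \<beta>. \<sigma> \<in> chambers \<Delta> \<Longrightarrow> \<beta> \<in> simple_roots \<Delta> \<sigma> \<Longrightarrow> \<beta> \<in> Pos \<Longrightarrow> P \<sigma> \<Longrightarrow> P (reflection \<beta> ` \<sigma>)"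
  shows "P \<sigma>"
  using assms(1)
proof (induction "card (positive_roots \<Delta> \<sigma> - Pos)" arbitrary: \<sigma> rule: less_induct)
  case less
  interpret t: chamber_base \<Delta> \<sigma> using less.prems by unfold_locales
  show ?case
  proof (cases "t.B \<subseteq> Pos")
    case True
    obtain v where v: "v \<in> C" using chamber_nonempty by blast
    have sub: "t.Pos \<subseteq> Pos"
    proof
      fix \<gamma> assume \<gamma>: "\<gamma> \<in> t.Pos"
      have "v \<bullet> \<gamma> \<ge> 0"
        unfolding t.inner_coord_expand[of v \<gamma>] using t.coord_Pos_Nats[OF \<gamma>] Pos_inner[OF _ v] True
        by (intro sum_nonneg mult_nonneg_nonneg) (auto simp: Nats_iff_nonneg_Ints inner_commute intro: less_imp_le)
      then show "\<gamma> \<in> Pos"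
        using chamber_regular[OF v t.Pos_root[OF \<gamma>]] Pos_iff[OF v] t.Pos_root[OF \<gamma>] by (simp add: inner_commute)
    qed
    have "Pos \<subseteq> t.Pos"
      using sub Pos_root t.Pos_or_minus_Pos minus_Pos by blast
    with sub have "t.Pos = Pos" by blast
    then have "\<sigma> = C" using t.mem_chamber_iff mem_chamber_iff by blast
    then show ?thesis using base by simp
  next
    case False
    then obtain \<beta> where \<beta>: "\<beta> \<in> t.B" "\<beta> \<notin> Pos" by blast
    note \<beta>r = t.simple_root[OF \<beta>(1)]
    interpret u: chamber_base \<Delta> "reflection \<beta> ` \<sigma>" using t.chamber_base_reflection \<beta>r by blast
    have invol: "reflection \<beta> (reflection \<beta> v) = v" for v
      using reflection_reflection[OF root_nonzero[OF \<beta>r]] .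
    have neg: "- \<beta> \<in> Pos" using Pos_or_minus_Pos \<beta> \<beta>r by blast
    \<comment> \<open>Crossing the wall of \<open>\<beta>\<close> only replaces
      \<open>\<beta>\<close> by \<open>- \<beta>\<close> among the positive roots, and
      \<open>- \<beta>\<close> lies in \<open>Pos\<close>.\<close>
    have "u.Pos - Pos \<subseteq> t.Pos - Pos"
    proof
      fix \<gamma> assume \<gamma>: "\<gamma> \<in> u.Pos - Pos"
      then have "reflection \<beta> \<gamma> \<in> t.Pos" using t.Pos_reflection[OF \<beta>r] by blast
      moreover have "reflection \<beta> \<gamma> \<noteq> \<beta>"
        using neg \<gamma> invol[of \<gamma>] reflection_self[OF root_nonzero[OF \<beta>r]] by auto
      ultimately show "\<gamma> \<in> t.Pos - Pos"
        using t.reflection_simple_Pos[OF \<beta>(1), of "reflection \<beta> \<gamma>"] invol \<gamma> by auto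
    qed
    moreover have "\<beta> \<in> t.Pos - Pos" "\<beta> \<notin> u.Pos"
      using \<beta> t.simple_pos t.minus_Pos u.minus_Pos[of \<beta>] u.simple_pos t.minus_simple_reflection by blast+
    ultimately have "u.Pos - Pos \<subset> t.Pos - Pos" by blast
    then have "P (reflection \<beta> ` \<sigma>)"
      using less.hyps u.chamber t.finite_Pos by (meson finite_Diff psubset_card_mono)
    \<comment> \<open>The nearer chamber is known; \<open>\<sigma>\<close> is reached from it by
      crossing back, with \<open>- \<beta>\<close> as the simple root.\<close>
    then have "P (reflection (- \<beta>) ` reflection \<beta> ` \<sigma>)"
      using step u.chamber t.minus_simple_reflection[OF \<beta>(1)] neg by blast
    then show ?thesis by (simp add: reflection_minus image_comp invol)
  qed
qed

section \<open>Vertices and lattice points of ample polytopes\<close>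

lemma ample_vertex_step:
  assumes "ample_with_vertices \<Delta> \<mu> P" "\<beta> \<in> B"
  obtains r :: int where "r > 0" "\<mu> (reflection \<beta> ` C) = \<mu> C - of_int r *\<^sub>R \<beta>"
proof -
  obtain r :: int where "r > 0" "\<mu> C - \<mu> (reflection \<beta> ` C) = of_int r *\<^sub>R \<beta>"
    using assms adjacent_reflection[OF assms(2)] separating_root_reflection[OF assms(2)]
    unfolding ample_with_vertices_def by metis
  then show thesis by (intro that[of r]) (auto simp: algebra_simps)
qed

text \<open>Each wall crossed away from \<open>C\<close> subtracts a positive multiple of a root in
  \<open>Pos\<close>.\<close>

lemma ample_vertices_below:
  assumes "ample_with_vertices \<Delta> \<mu> P" "\<sigma> \<in> chambers \<Delta>"
  shows "below (\<mu> \<sigma>) (\<mu> C)"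
  using assms(2)
proof (induction rule: chamber_induct)
  case base
  then show ?case by (simp add: below_def coord_zero)
next
  case (step \<sigma> \<beta>)
  interpret t: chamber_base \<Delta> \<sigma> using step by unfold_locales
  obtain r :: int where r: "r > 0" "\<mu> (reflection \<beta> ` \<sigma>) = \<mu> \<sigma> - of_int r *\<^sub>R \<beta>"
    using t.ample_vertex_step[OF assms(1) step(2)] .
  have "coord \<gamma> (\<mu> C - \<mu> (reflection \<beta> ` \<sigma>)) = coord \<gamma> (\<mu> C - \<mu> \<sigma>) + of_int r * coord \<gamma> \<beta>" for \<gamma>
    by (simp add: r coord_diff coord_scaleR)
  then show ?case
    using step(4) r(1) coord_Pos_Nats[OF step(3)] unfolding below_def Nats_iff_nonneg_Ints by auto
qed

text \<open>Crossing the wall of \<open>\<beta>\<close> only changes the coefficient of \<open>\<beta>\<close>. With \<open>m\<close> its new value at \<open>- \<beta>\<close>,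
  pairing with the coroot of \<open>- \<beta>\<close> gives \<open>2 m \<ge> -1\<close>, and \<open>m\<close> is an integer.\<close>
lemma below_all_vertices:
  assumes ample: "ample_with_vertices \<Delta> \<mu> P" and dom: "\<And>\<sigma>. \<sigma> \<in> chambers \<Delta> \<Longrightarrow> dominant_for \<Delta> \<sigma> (\<mu> \<sigma>)"
    and w: "almost_dominant w" "below w (\<mu> C)" and "\<sigma> \<in> chambers \<Delta>"
  shows "chamber_base.below \<Delta> \<sigma> w (\<mu> \<sigma>)"
  using assms(5)
proof (induction rule: chamber_induct)
  case base
  then show ?case using w by blast
next
  case (step \<sigma> \<beta>)
  interpret t: chamber_base \<Delta> \<sigma> using step by unfold_locales
  note \<beta>r = t.simple_root[OF step(2)]
  interpret u: chamber_base \<Delta> "reflection \<beta> ` \<sigma>" using t.chamber_base_reflection \<beta>r by blast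
  note nz = root_nonzero[OF \<beta>r]
  have invol: "reflection \<beta> (reflection \<beta> v) = v" for v using reflection_reflection[OF nz] .
  obtain r :: int where r: "r > 0" "\<mu> (reflection \<beta> ` \<sigma>) = \<mu> \<sigma> - of_int r *\<^sub>R \<beta>"
    using t.ample_vertex_step[OF ample step(2)] .
  define D where "D = \<mu> (reflection \<beta> ` \<sigma>) - w"
  have D_Int: "copair D \<beta> \<in> \<int>"
    using ample u.chamber w(1) \<beta>r weight_lattice_Ints weight_lattice_diff almost_dominant_weight
    unfolding D_def ample_with_vertices_def by blast
  have coord: "u.coord (reflection \<beta> \<gamma>) D
      = t.coord \<gamma> (\<mu> \<sigma> - w) - (of_int r + copair D \<beta>) * (if \<gamma> = \<beta> then 1 else 0)" if "\<gamma> \<in> t.B" for \<gamma>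
  proof -
    have "reflection \<beta> D = (\<mu> \<sigma> - w) - (of_int r + copair D \<beta>) *\<^sub>R \<beta>"
      by (simp add: reflection_def) (simp add: D_def r algebra_simps)
    then have "t.coord \<gamma> (reflection \<beta> D)
        = t.coord \<gamma> (\<mu> \<sigma> - w) - (of_int r + copair D \<beta>) * (if \<gamma> = \<beta> then 1 else 0)"
      by (simp add: t.coord_diff[of _ "\<mu> \<sigma> - w"] t.coord_scaleR t.coord_simple[OF step(2)])
    then show ?thesis
      using t.coord_reflection[OF \<beta>r that, of "reflection \<beta> D"] by (simp only: invol)
  qed
  have nat: "u.coord \<delta> D \<in> \<nat>" if \<delta>: "\<delta> \<in> u.B" "\<delta> \<noteq> - \<beta>" for \<delta>
  proof -
    have "reflection \<beta> \<delta> \<in> t.B" using t.simple_reflection[OF \<beta>r] \<delta> by blast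
    moreover have "reflection \<beta> \<delta> \<noteq> \<beta>" using invol[of \<delta>] reflection_self[OF nz] \<delta> by auto
    ultimately show ?thesis using coord[of "reflection \<beta> \<delta>"] step(4) by (simp add: invol t.below_def)
  qed
  note mb = t.minus_simple_reflection[OF step(2)]
  have int: "u.coord (- \<beta>) D \<in> \<int>"
    using coord[OF step(2)] D_Int step(2,4)
    by (auto simp: reflection_self[OF nz] t.below_def Nats_iff_nonneg_Ints)
  have "copair D (- \<beta>) = (\<Sum>\<delta>\<in>u.B. u.coord \<delta> D * copair \<delta> (- \<beta>))"
    by (rule u.copair_coord_expand)
  also have "\<dots> = 2 * u.coord (- \<beta>) D + (\<Sum>\<delta>\<in>u.B - {- \<beta>}. u.coord \<delta> D * copair \<delta> (- \<beta>))"
    using sum.remove[OF u.finite_simple mb, of "\<lambda>\<delta>. u.coord \<delta> D * copair \<delta> (- \<beta>)"]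
      copair_self[of "- \<beta>"] nz by simp
  also have "(\<Sum>\<delta>\<in>u.B - {- \<beta>}. u.coord \<delta> D * copair \<delta> (- \<beta>)) \<le> 0"
    using nat u.copair_simple_nonpos[OF mb]
    by (intro sum_nonpos mult_nonneg_nonpos) (auto simp: Nats_iff_nonneg_Ints)
  finally have "copair D (- \<beta>) \<le> 2 * u.coord (- \<beta>) D" by simp
  moreover have "copair (\<mu> (reflection \<beta> ` \<sigma>)) (- \<beta>) \<ge> 0"
    using dom[OF u.chamber] mb by (simp add: dominant_for_def)
  moreover have "copair w \<beta> \<ge> -1" using almost_dominantD[OF w(1) step(3)] .
  ultimately have "2 * u.coord (- \<beta>) D \<ge> -1" by (simp add: D_def copair_diff copair_minus_right)
  with int have "u.coord (- \<beta>) D \<in> \<nat>"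
    using Ints_neg_le_minus_1[of "u.coord (- \<beta>) D"] by (force simp: Nats_iff_nonneg_Ints)
  then show ?case using nat unfolding u.below_def D_def by blast
qed

lemma exists_regular:
  assumes "open U" "U \<noteq> {}"
  shows "\<exists>u\<in>U. \<forall>\<alpha>\<in>\<Delta>. \<alpha> \<bullet> u \<noteq> 0"
proof (rule ccontr)
  assume "\<not> ?thesis"
  then have "U \<subseteq> (\<Union>\<alpha>\<in>\<Delta>. {v. \<alpha> \<bullet> v = 0})" by blast
  moreover have "negligible (\<Union>\<alpha>\<in>\<Delta>. {v. \<alpha> \<bullet> v = 0})"
    using finite_roots root_nonzero by (intro negligible_Union) (auto simp: negligible_hyperplane)
  ultimately show False using open_not_negligible assms negligible_subset by blast
qed

lemma ample_eq_convex_hull: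
  assumes "ample_with_vertices \<Delta> \<mu> P"
  shows "P = convex hull (\<mu> ` chambers \<Delta>)"
proof -
  have "polytope P" and V: "{v. v extreme_point_of P} = \<mu> ` chambers \<Delta>"
    using assms by (auto simp: ample_with_vertices_def)
  then show ?thesis
    using Krein_Milman_Minkowski[OF polytope_imp_compact polytope_imp_convex, of P] by (simp only: V)
qed

text \<open>A hyperplane separating \<open>w\<close> from the polytope would give a direction in
  which \<open>w\<close> exceeds all vertices. In a chamber containing such a direction,
  \<open>below_all_vertices\<close> says the opposite for the vertex of that chamber.\<close>

lemma almost_dominant_below_imp_mem:
  assumes ample: "ample_with_vertices \<Delta> \<mu> P" and dom: "\<And>\<sigma>. \<sigma> \<in> chambers \<Delta> \<Longrightarrow> dominant_for \<Delta> \<sigma> (\<mu> \<sigma>)"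
    and w: "almost_dominant w" "below w (\<mu> C)"
  shows "w \<in> P"
proof (rule ccontr)
  assume "w \<notin> P"
  have P: "polytope P" and V: "{v. v extreme_point_of P} = \<mu> ` chambers \<Delta>"
    using ample by (auto simp: ample_with_vertices_def)
  have fin: "finite (\<mu> ` chambers \<Delta>)"
    unfolding V[symmetric] using P finite_polyhedron_extreme_points polytope_imp_polyhedron by blast
  obtain a b where ab: "a \<bullet> w < b" "\<And>x. x \<in> P \<Longrightarrow> a \<bullet> x > b"
    using separating_hyperplane_closed_point[OF polytope_imp_convex[OF P] polytope_imp_closed[OF P] \<open>w \<notin> P\<close>] by blast
  \<comment> \<open>The direction \<open>- a\<close> may lie on root hyperplanes. Finitely many
    strict inequalities define an open set, so it can be perturbed into a chamber.\<close>
  let ?U = "\<Inter>v\<in>\<mu> ` chambers \<Delta>. {u. (w - v) \<bullet> u > 0}"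
  have "open ?U" using fin by (intro open_INT) (auto simp: open_halfspace_gt)
  moreover have "- a \<in> ?U"
  proof
    fix v assume "v \<in> \<mu> ` chambers \<Delta>"
    then have "v \<in> P" using V by (auto simp: extreme_point_of_def)
    then show "- a \<in> {u. (w - v) \<bullet> u > 0}"
      using ab(1) ab(2)[of v] by (simp add: inner_diff_left inner_diff_right inner_commute)
  qed
  ultimately obtain u where u: "u \<in> ?U" "\<forall>\<alpha>\<in>\<Delta>. \<alpha> \<bullet> u \<noteq> 0" using exists_regular[of ?U] by blast
  let ?R = "UNIV - (\<Union>\<alpha>\<in>\<Delta>. {v. \<alpha> \<bullet> v = 0})"
  have "u \<in> ?R" using u(2) by blast
  then obtain \<sigma> where \<sigma>: "\<sigma> \<in> chambers \<Delta>" "u \<in> \<sigma>"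
    using Union_components[of ?R] unfolding chambers_def by blast
  interpret t: chamber_base \<Delta> \<sigma> using \<sigma> by unfold_locales
  have "u \<bullet> (\<mu> \<sigma> - w) \<ge> 0"
    unfolding t.inner_coord_expand[of u "\<mu> \<sigma> - w"] using t.belowD[OF below_all_vertices[OF ample dom w \<sigma>(1)]]
      t.Pos_inner[OF t.simple_pos \<sigma>(2)]
    by (intro sum_nonneg mult_nonneg_nonneg) (auto simp: inner_commute intro: less_imp_le)
  moreover have "(w - \<mu> \<sigma>) \<bullet> u > 0" using u(1) \<sigma>(1) by blast
  ultimately show False by (simp add: inner_commute inner_diff_right)
qed

text \<open>This is a linear inequality that holds at the vertices, hence on their hull; it applies
  to all points of \<open>P\<close>, not only to those in the lattice.\<close>

lemma ample_coord_nonneg: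
  assumes "ample_with_vertices \<Delta> \<mu> P" "x \<in> P" "\<beta> \<in> B"
  shows "coord \<beta> (\<mu> C - x) \<ge> 0"
proof -
  have "convex {x. coord \<beta> x \<le> coord \<beta> (\<mu> C)}"
  proof (rule convexI)
    fix x y and u v :: real
    assume *: "x \<in> {x. coord \<beta> x \<le> coord \<beta> (\<mu> C)}" "y \<in> {x. coord \<beta> x \<le> coord \<beta> (\<mu> C)}"
      "0 \<le> u" "0 \<le> v" "u + v = 1"
    then have "u * coord \<beta> x + v * coord \<beta> y \<le> coord \<beta> (\<mu> C)"
      by (intro convex_bound_le) auto
    then show "u *\<^sub>R x + v *\<^sub>R y \<in> {x. coord \<beta> x \<le> coord \<beta> (\<mu> C)}" by (simp add: coord_add coord_scaleR)
  qed
  moreover have "\<mu> ` chambers \<Delta> \<subseteq> {x. coord \<beta> x \<le> coord \<beta> (\<mu> C)}"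
    using belowD[OF ample_vertices_below[OF assms(1)] assms(3)] by (auto simp: coord_diff)
  ultimately have "P \<subseteq> {x. coord \<beta> x \<le> coord \<beta> (\<mu> C)}"
    unfolding ample_eq_convex_hull[OF assms(1)] by (intro hull_minimal)
  then show ?thesis using assms(2) by (auto simp: coord_diff)
qed

text \<open>All vertices share one coset, so the choice of extreme point in
  \<open>Lambda_pts\<close> does not matter.\<close>

lemma ample_vertex_lattice:
  assumes "ample_with_vertices \<Delta> \<mu> P" "v extreme_point_of P"
  shows "\<mu> C - v \<in> root_lattice \<Delta>"
proof -
  have "v \<in> \<mu> ` chambers \<Delta>" using assms by (auto simp: ample_with_vertices_def)
  then show ?thesis
    using ample_vertices_below[OF assms(1)] by (auto simp: root_lattice_iff below_def Nats_iff_nonneg_Ints)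
qed

lemma winning_Lambda_iff:
  assumes ample: "ample_with_vertices \<Delta> \<mu> P" and dom: "\<And>\<sigma>. \<sigma> \<in> chambers \<Delta> \<Longrightarrow> dominant_for \<Delta> \<sigma> (\<mu> \<sigma>)"
  shows "w \<in> Lambda_pts \<Delta> P \<and> winning \<Delta> C w \<longleftrightarrow> almost_dominant w \<and> below w (\<mu> C)"
proof (intro iffI conjI)
  assume *: "w \<in> Lambda_pts \<Delta> P \<and> winning \<Delta> C w"
  then show "almost_dominant w" using winning_iff by blast
  obtain v where v: "v extreme_point_of P" "w - v \<in> root_lattice \<Delta>" and wP: "w \<in> P"
    using * by (auto simp: Lambda_pts_def)
  have "coord \<beta> (\<mu> C - w) \<in> \<nat>" if "\<beta> \<in> B" for \<beta>
  proof -
    have "coord \<beta> (\<mu> C - w) = coord \<beta> (\<mu> C - v) - coord \<beta> (w - v)" by (simp add: coord_diff)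
    then have "coord \<beta> (\<mu> C - w) \<in> \<int>"
      using ample_vertex_lattice[OF ample v(1)] v(2) that by (simp add: root_lattice_iff)
    then show ?thesis using ample_coord_nonneg[OF ample wP that] by (simp add: Nats_iff_nonneg_Ints)
  qed
  then show "below w (\<mu> C)" by (simp add: below_def)
next
  assume *: "almost_dominant w \<and> below w (\<mu> C)"
  then show "winning \<Delta> C w" using winning_iff by blast
  have "coord \<beta> (w - \<mu> C) = - coord \<beta> (\<mu> C - w)" for \<beta> by (simp add: coord_diff)
  then have "w - \<mu> C \<in> root_lattice \<Delta>"
    using * by (simp add: root_lattice_iff below_def Nats_iff_nonneg_Ints)
  moreover have "\<mu> C extreme_point_of P"
    using ample chamber by (auto simp: ample_with_vertices_def)
  ultimately show "w \<in> Lambda_pts \<Delta> P"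
    using almost_dominant_below_imp_mem[OF ample dom] * unfolding Lambda_pts_def by blast
qed

end

text \<open>A segment through the summand \<open>p j\<close> translates to one through the sum by
  fixing the other summands. This finds the coset of an extreme point of the Minkowski sum without
  first showing that the sum is ample.\<close>

lemma extreme_point_of_set_sum:
  fixes S :: "'i \<Rightarrow> 'a::real_vector set"
  assumes "finite I" and ext: "sum p I extreme_point_of sum S I" and p: "\<And>i. i \<in> I \<Longrightarrow> p i \<in> S i" and j: "j \<in> I"
  shows "p j extreme_point_of S j"
  unfolding extreme_point_of_def
proof (intro conjI ballI notI)
  show "p j \<in> S j" using p j .
  fix a b assume ab: "a \<in> S j" "b \<in> S j" "p j \<in> open_segment a b"
  let ?c = "sum p (I - {j})"
  have mem: "?c + d \<in> sum S I" if "d \<in> S j" for d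
  proof -
    have "?c + d = sum (p(j := d)) I"
      using assms(1) j by (simp add: sum.remove add.commute)
    then show ?thesis
      using that p assms(1) by (auto simp: set_sum_alt intro!: exI[of _ "p(j := d)"])
  qed
  have "?c + p j \<in> open_segment (?c + a) (?c + b)"
    using ab(3) by (simp add: open_segment_translation)
  moreover have "sum p I = ?c + p j" using assms(1) j by (simp add: sum.remove add.commute)
  ultimately show False using ext mem ab unfolding extreme_point_of_def by metis
qed

theorem theoremA1:
  fixes \<Delta> :: "'a::euclidean_space set" and C :: "'a set"
    and m :: nat and P :: "nat \<Rightarrow> 'a set" and x :: 'a
  assumes "root_system \<Delta>" and "reduced_roots \<Delta>" and "irreducible_roots \<Delta>"
    and "C \<in> chambers \<Delta>"
    and "m \<ge> 1"
    and "\<And>i. i \<in> {1..m} \<Longrightarrow> special_ample_polytope \<Delta> (P i)"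
    and "x \<in> Lambda_pts \<Delta> (\<Sum>i=1..m. P i)"
    and "winning \<Delta> C x"
  shows "(\<exists>xs\<in>winning_tuples \<Delta> C m P. x = (\<Sum>i=1..m. xs i)) \<and>
    (\<forall>xs\<in>winning_tuples \<Delta> C m P. \<forall>ys\<in>winning_tuples \<Delta> C m P.
       (\<Sum>i=1..m. xs i) = x \<and> x = (\<Sum>i=1..m. ys i) \<longrightarrow>
       (\<lambda>us vs. us \<in> winning_tuples \<Delta> C m P \<and> vs \<in> winning_tuples \<Delta> C m P
          \<and> root_move \<Delta> m P us vs)\<^sup>*\<^sup>* xs ys)"
proof -
  interpret chamber_base \<Delta> C using assms(1,2,4) by unfold_locales
  obtain M where ample: "\<And>i. i \<in> {1..m} \<Longrightarrow> ample_with_vertices \<Delta> (M i) (P i)"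
    and dom: "\<And>i \<sigma>. i \<in> {1..m} \<Longrightarrow> \<sigma> \<in> chambers \<Delta> \<Longrightarrow> dominant_for \<Delta> \<sigma> (M i \<sigma>)"
    using assms(6) unfolding special_ample_polytope_def by metis
  define \<nu> where "\<nu> i = M i C" for i
  interpret tuples_below \<Delta> C "{1..m}" \<nu>
    using dom chamber by unfold_locales (auto simp: \<nu>_def)
  have Lambda: "w \<in> Lambda_pts \<Delta> (P i) \<and> winning \<Delta> C w \<longleftrightarrow> almost_dominant w \<and> below w (\<nu> i)" if "i \<in> {1..m}" for i w
    using winning_Lambda_iff[OF ample[OF that] dom[OF that]] by (simp add: \<nu>_def)
  have tuples: "winning_tuples \<Delta> C m P = tuples"
    unfolding set_eq_iff winning_tuples_def Lambda_tuples_def tuples_def mem_Collect_eq PiE_iff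
    using Lambda by blast
  have move: "root_move \<Delta> m P us vs" if st: "step us vs" for us vs
  proof -
    have in_\<Lambda>: "us \<in> Lambda_tuples \<Delta> m P" "vs \<in> Lambda_tuples \<Delta> m P"
      using st unfolding step_def tuples[symmetric] winning_tuples_def by blast+
    obtain \<beta> i j where *: "\<beta> \<in> \<Delta>" "i \<in> {1..m}" "j \<in> {1..m}" "i \<noteq> j" "vs = us(i := us i + \<beta>, j := us j - \<beta>)"
      using st unfolding step_def by blast
    then have "us i + \<beta> \<in> Lambda_pts \<Delta> (P i)" "us j - \<beta> \<in> Lambda_pts \<Delta> (P j)"
      using PiE_mem[OF in_\<Lambda>(2)[unfolded Lambda_tuples_def], of i]
        PiE_mem[OF in_\<Lambda>(2)[unfolded Lambda_tuples_def], of j] by simp_all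
    then show ?thesis using in_\<Lambda>(1) * unfolding root_move_def by blast
  qed
  have "below x (sum \<nu> {1..m})"
    unfolding below_def Nats_iff_nonneg_Ints
  proof (intro ballI conjI)
    fix \<beta> assume \<beta>: "\<beta> \<in> B"
    obtain v where v: "v extreme_point_of sum P {1..m}" "x - v \<in> root_lattice \<Delta>" and "x \<in> sum P {1..m}"
      using assms(7) by (auto simp: Lambda_pts_def)
    \<comment> \<open>Two decompositions serve different ends: the points \<open>p i\<close> are
      arbitrary and give nonnegativity, while the \<open>q i\<close> are extreme points and give
      integrality.\<close>
    then obtain p q where p: "x = sum p {1..m}" "\<And>i. i \<in> {1..m} \<Longrightarrow> p i \<in> P i"
      and q: "v = sum q {1..m}" "\<And>i. i \<in> {1..m} \<Longrightarrow> q i \<in> P i"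
      by (auto simp: set_sum_alt extreme_point_of_def)
    have "coord \<beta> (sum \<nu> {1..m} - x) = (\<Sum>i=1..m. coord \<beta> (\<nu> i - p i))"
      by (simp add: p(1) coord_diff coord_sum sum_subtractf)
    also have "\<dots> \<ge> 0"
      using ample_coord_nonneg[OF ample p(2) \<beta>] by (intro sum_nonneg) (auto simp: \<nu>_def)
    finally show "coord \<beta> (sum \<nu> {1..m} - x) \<ge> 0" .
    have "coord \<beta> (\<nu> i - q i) \<in> \<int>" if i: "i \<in> {1..m}" for i
      using ample_vertex_lattice[OF ample[OF i] extreme_point_of_set_sum[OF _ v(1)[unfolded q(1)] q(2) i]] \<beta>
      by (simp add: root_lattice_iff \<nu>_def)
    then have "(\<Sum>i=1..m. coord \<beta> (\<nu> i - q i)) - coord \<beta> (x - v) \<in> \<int>"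
      using v(2) \<beta> by (auto simp: root_lattice_iff intro!: Ints_diff Ints_sum)
    moreover have "coord \<beta> (sum \<nu> {1..m} - x) = (\<Sum>i=1..m. coord \<beta> (\<nu> i - q i)) - coord \<beta> (x - v)"
      by (simp add: q(1) coord_diff coord_sum sum_subtractf)
    ultimately show "coord \<beta> (sum \<nu> {1..m} - x) \<in> \<int>" by simp
  qed
  moreover have "\<nu> i \<in> weight_lattice \<Delta>" if "i \<in> {1..m}" for i
    using ample[OF that] chamber by (simp add: \<nu>_def ample_with_vertices_def)
  ultimately have fib: "connected_fiber x" using connected_fiber assms(8) winning_iff by blast
  let ?R = "\<lambda>us vs. us \<in> winning_tuples \<Delta> C m P \<and> vs \<in> winning_tuples \<Delta> C m P \<and> root_move \<Delta> m P us vs"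
  have "?R us vs" if "step us vs" for us vs
    using that move[OF that] unfolding step_def tuples by simp
  then have "step\<^sup>*\<^sup>* xs ys \<longrightarrow> ?R\<^sup>*\<^sup>* xs ys" for xs ys
    by (intro mono_rtranclp) blast
  then have conn: "?R\<^sup>*\<^sup>* xs ys" if "xs \<in> tuples_of_sum x" "ys \<in> tuples_of_sum x" for xs ys
    using fib that unfolding connected_fiber_def by blast
  show ?thesis
  proof (intro conjI ballI impI)
    obtain xs where "xs \<in> tuples_of_sum x" using fib unfolding connected_fiber_def by blast
    then show "\<exists>xs\<in>winning_tuples \<Delta> C m P. x = (\<Sum>i=1..m. xs i)"
      unfolding tuples tuples_of_sum_def by blast
    fix xs ys
    assume "xs \<in> winning_tuples \<Delta> C m P" "ys \<in> winning_tuples \<Delta> C m P"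
      "(\<Sum>i=1..m. xs i) = x \<and> x = (\<Sum>i=1..m. ys i)"
    then have "xs \<in> tuples_of_sum x" "ys \<in> tuples_of_sum x"
      unfolding tuples tuples_of_sum_def by simp_all
    then show "?R\<^sup>*\<^sup>* xs ys" by (rule conn)
  qed
qed

end
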